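(* Suppose that $T$ is a split SLAG subvariety with compact support in $\mathbb{D}^n$. Suppose $S$ is a positive space-like compactly supported rectifiable $n$-current on $\mathbb{D}^n$ with $dS=dT$. Then $$\mathrm{vol}(T)\ \ge\ \mathrm{vol}(S),$$ and equality holds if and only if $S$ is also a split SLAG subvariety.
   Context: $\mathbb{D}$ denotes the double numbers: the real algebra generated by $1,\tau$ with $\tau^2=1$; $\mathrm{Re}(x+\tau y)=x$, $\mathrm{Im}(x+\tau y)=y$. $\mathbb{D}^n=\mathbb{R}^n\oplus\tau\mathbb{R}^n$ has coordinates $z_j=x_j+\tau y_j$, the inner product of signature $(n,n)$ with quadratic form $\langle z,z\rangle=\sum_j(x_j^2-y_j^2)$, the symplectic form $\omega=\sum_jdx_j\wedge dy_j$, and the $\mathbb{D}$-valued $n$-form $dz=dz_1\wedge\cdots\wedge dz_n$. $G^+_{\rm space}(n,\mathbb{D}^n)$ is the set of positive space-like $n$-planes: oriented $n$-planes on which $\langle\cdot,\cdot\rangle$ is positive definite and whose projection to $\mathbb{R}^n$ along $\tau\mathbb{R}^n$ preserves the standard orientation. Each such plane is identified with the $n$-vector $\epsilon_1\wedge\cdots\wedge\epsilon_n\in\Lambda^n_{\mathbb{R}}\mathbb{D}^n$ for any oriented basis orthonormal with respect to $\langle\cdot,\cdot\rangle$. $\widetilde{\rm SLAG}$ is the subset of those $\xi\in G^+_{\rm space}(n,\mathbb{D}^n)$ which are Lagrangian ($\omega|_\xi=0$) and satisfy $\mathrm{Im}\,dz|_\xi=0$. A locally rectifiable $n$-current $T$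 is positive space-like if its oriented approximate tangent plane lies in $G^+_{\rm space}(n,\mathbb{D}^n)$ almost everywhere; it is then written uniquely as $T(\varphi)=\int\varphi(\overrightarrow{T})\,d\|T\|$ with $\|T\|$ a non-negative Radon measure and $\overrightarrow{T}\in G^+_{\rm space}(n,\mathbb{D}^n)\subset\Lambda^n_{\mathbb{R}}\mathbb{D}^n$ for $\|T\|$-a.a. points, and $\mathrm{vol}(T)=\int\|T\|$. $T$ is a split SLAG subvariety if it is a locally rectifiable $n$-current with $\overrightarrow{T}\in\widetilde{\rm SLAG}$ for $\|T\|$-a.a. points. $dT$ denotes the boundary of the current $T$. *)

theory Defs
  imports "HOL-Analysis.Analysis"
begin

section \<open>The double numbers\<close>

codatatype double = Double (DRe: real) (DIm: real)

lemma double_eq_iff: "x = y \<longleftrightarrow> DRe x = DRe y \<and> DIm x = DIm y"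
  by (auto intro: double.expand)

lemma double_eqI: "DRe x = DRe y \<Longrightarrow> DIm x = DIm y \<Longrightarrow> x = y"
  by (simp add: double_eq_iff)

instantiation double :: comm_ring_1
begin

primcorec zero_double where "DRe 0 = 0" | "DIm 0 = 0"
primcorec one_double where "DRe 1 = 1" | "DIm 1 = 0"
primcorec plus_double where "DRe (x + y) = DRe x + DRe y" | "DIm (x + y) = DIm x + DIm y"
primcorec uminus_double where "DRe (- x) = - DRe x" | "DIm (- x) = - DIm x"
primcorec minus_double where "DRe (x - y) = DRe x - DRe y" | "DIm (x - y) = DIm x - DIm y"
primcorec times_double where
  "DRe (x * y) = DRe x * DRe y + DIm x * DIm y"
| "DIm (x * y) = DRe x * DIm y + DIm x * DRe y"

instance
  by standard (simp_all add: double_eq_iff algebra_simps)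

end

definition tau :: double where "tau = Double 0 1"

lemma tau_sel [simp]: "DRe tau = 0" "DIm tau = 1"
  by (simp_all add: tau_def)

lemma tau_squared: "tau * tau = 1"
  by (simp add: double_eq_iff)

instantiation double :: real_algebra_1
begin

primcorec scaleR_double where
  "DRe (scaleR r x) = r * DRe x"
| "DIm (scaleR r x) = r * DIm x"

instance
  by standard (simp_all add: double_eq_iff algebra_simps)

end

lemma double_expand: "z = of_real (DRe z) + tau * of_real (DIm z)"
  by (simp add: double_eq_iff of_real_def)

text \<open>The norm and inner product of the type classes are the auxiliary Euclidean ones, which carry
  the topology, Lipschitz maps and Hausdorff measure. The indefinite form is \<open>split_inner\<close>
  below.\<close>

instantiation double :: real_inner
begin

definition inner_double :: "double \<Rightarrow> double \<Rightarrow> real" where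
  "inner_double x y = DRe x * DRe y + DIm x * DIm y"

definition norm_double :: "double \<Rightarrow> real" where
  "norm_double x = sqrt (inner x x)"

definition sgn_double :: "double \<Rightarrow> double" where
  "sgn_double x = x /\<^sub>R norm x"

definition dist_double :: "double \<Rightarrow> double \<Rightarrow> real" where
  "dist_double x y = norm (x - y)"

definition uniformity_double :: "(double \<times> double) filter" where
  "uniformity_double = (INF e\<in>{0 <..}. principal {(x, y). dist x y < e})"

definition open_double :: "double set \<Rightarrow> bool" where
  "open_double U \<longleftrightarrow> (\<forall>x\<in>U. eventually (\<lambda>(x', y). x' = x \<longrightarrow> y \<in> U) uniformity)"

instance
proof
  fix x y z :: double and r :: real
  show "inner x y = inner y x"
    by (simp add: inner_double_def mult.commute)
  show "inner (x + y) z = inner x z + inner y z"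
    by (simp add: inner_double_def algebra_simps)
  show "inner (scaleR r x) y = r * inner x y"
    by (simp add: inner_double_def algebra_simps)
  show "0 \<le> inner x x"
    by (simp add: inner_double_def)
  show "inner x x = 0 \<longleftrightarrow> x = 0"
    by (simp add: inner_double_def double_eq_iff add_nonneg_eq_0_iff)
qed (simp_all only: norm_double_def sgn_double_def dist_double_def uniformity_double_def
      open_double_def)

end

instantiation double :: euclidean_space
begin

definition Basis_double :: "double set" where "Basis_double = {1, tau}"

instance
proof
  fix u v :: double
  have "(1 :: double) \<noteq> tau"
    by (simp add: double_eq_iff)
  moreover assume "u \<in> Basis" "v \<in> Basis"
  then have "u = 1 \<or> u = tau" "v = 1 \<or> v = tau"
    by (simp_all add: Basis_double_def)
  ultimately show "inner u v = (if u = v then 1 else 0)"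
    by (elim disjE) (simp_all add: inner_double_def)
next
  fix x :: double
  show "(\<forall>u\<in>Basis. inner x u = 0) \<longleftrightarrow> x = 0"
    by (simp add: Basis_double_def inner_double_def double_eq_iff[of x])
qed (simp_all add: Basis_double_def)

end


section \<open>Multicovectors, multivectors and test forms\<close>

text \<open>A \<open>k\<close>-covector is an alternating \<open>k\<close>-linear function on lists of length \<open>k\<close>, extended by \<open>0\<close> to
  lists of other lengths so that covectors are equal iff they agree as multilinear maps.\<close>

definition covectors :: "nat \<Rightarrow> ('v::real_vector list \<Rightarrow> real) set" where
  "covectors k = {\<alpha>.
     (\<forall>vs. length vs \<noteq> k \<longrightarrow> \<alpha> vs = 0) \<and>
     (\<forall>vs i. length vs = k \<longrightarrow> i < k \<longrightarrow> linear (\<lambda>v. \<alpha> (vs[i := v]))) \<and>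
     (\<forall>vs i j. length vs = k \<longrightarrow> i < j \<longrightarrow> j < k \<longrightarrow> vs ! i = vs ! j \<longrightarrow> \<alpha> vs = 0)}"

text \<open>\<open>k\<close>-vectors are represented in the dual of the space of \<open>k\<close>-covectors;
  \<open>wedge [v\<^sub>1, \<dots>, v\<^sub>k]\<close> is the simple \<open>k\<close>-vector \<open>v\<^sub>1 \<and> \<dots> \<and> v\<^sub>k\<close>, paired with covectors without a
  factor \<open>1/k!\<close>.\<close>

type_synonym 'v multivector = "('v list \<Rightarrow> real) \<Rightarrow> real"

definition wedge :: "'v::real_vector list \<Rightarrow> 'v multivector" where
  "wedge vs = (\<lambda>\<alpha>. if \<alpha> \<in> covectors (length vs) then \<alpha> vs else 0)"

primrec C_k :: "nat \<Rightarrow> ('v::real_normed_vector \<Rightarrow> real) \<Rightarrow> bool" where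
  "C_k 0 f \<longleftrightarrow> continuous_on UNIV f"
| "C_k (Suc k) f \<longleftrightarrow> f differentiable_on UNIV \<and> (\<forall>v. C_k k (\<lambda>x. frechet_derivative f (at x) v))"

type_synonym 'v form = "'v \<Rightarrow> 'v list \<Rightarrow> real"

definition form_support :: "'v::topological_space form \<Rightarrow> 'v set" where
  "form_support \<phi> = closure {x. \<exists>vs. \<phi> x vs \<noteq> 0}"

definition test_forms :: "nat \<Rightarrow> 'v::real_normed_vector form set" where
  "test_forms k = {\<phi>. (\<forall>x. \<phi> x \<in> covectors k) \<and> (\<forall>vs m. C_k m (\<lambda>x. \<phi> x vs)) \<and>
     compact (form_support \<phi>)}"

definition ext_deriv :: "'v::real_normed_vector form \<Rightarrow> 'v form" where
  "ext_deriv \<psi> = (\<lambda>x vs. \<Sum>i<length vs. (-1) ^ i *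
     frechet_derivative (\<lambda>y. \<psi> y (take i vs @ drop (Suc i) vs)) (at x) (vs ! i))"


section \<open>Hausdorff measure and approximate tangent planes\<close>

definition hausdorff_pre :: "nat \<Rightarrow> real \<Rightarrow> 'v::metric_space set \<Rightarrow> ennreal" where
  "hausdorff_pre k \<delta> A =
     (INF C \<in> {C :: nat \<Rightarrow> 'v set. A \<subseteq> (\<Union>i. C i) \<and> (\<forall>i. bounded (C i) \<and> diameter (C i) \<le> \<delta>)}.
        \<Sum>i. ennreal (unit_ball_vol (real k) * (diameter (C i) / 2) ^ k))"

text \<open>The \<open>k\<close>-dimensional Hausdorff measure (\<open>k \<ge> 1\<close>) on the Borel sets, where it is countably
  additive by Caratheodory's criterion for metric outer measures.\<close>

definition hausdorff_measure :: "nat \<Rightarrow> 'v::metric_space measure" where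
  "hausdorff_measure k = measure_of UNIV (sets borel) (\<lambda>A. SUP \<delta>\<in>{0<..}. hausdorff_pre k \<delta> A)"

text \<open>\<open>P\<close> is the approximate tangent plane of \<open>M\<close> at \<open>x\<close> if the blow-ups of \<open>\<H>\<^sup>k\<close> restricted to \<open>M\<close>
  converge vaguely to \<open>\<H>\<^sup>k\<close> restricted to \<open>P\<close>; here \<open>M\<close> is assumed to have locally finite measure.\<close>

definition approx_tangent_plane :: "nat \<Rightarrow> 'v::euclidean_space set \<Rightarrow> 'v \<Rightarrow> 'v set \<Rightarrow> bool" where
  "approx_tangent_plane k M x P \<longleftrightarrow> subspace P \<and> dim P = k \<and>
     (\<forall>f :: 'v \<Rightarrow> real. continuous_on UNIV f \<longrightarrow> compact (closure {y. f y \<noteq> 0}) \<longrightarrow>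
        ((\<lambda>r. (LINT y:M|hausdorff_measure k. f ((y - x) /\<^sub>R r)) / r ^ k)
           \<longlongrightarrow> (LINT y:P|hausdorff_measure k. f y)) (at_right 0))"


section \<open>Currents\<close>

text \<open>Only the values of a current on test \<open>n\<close>-forms matter. Linearity and continuity are not
  imposed separately, since they follow from the integral representation of locally rectifiable
  currents.\<close>

type_synonym 'n Dn = "(double, 'n) vec"

type_synonym 'n current = "'n Dn form \<Rightarrow> real"

definition current_support :: "'n::finite current \<Rightarrow> 'n Dn set" where
  "current_support T = {x. \<forall>U. open U \<longrightarrow> x \<in> U \<longrightarrow>
     (\<exists>\<phi> \<in> test_forms CARD('n). form_support \<phi> \<subseteq> U \<and> T \<phi> \<noteq> 0)}"

definition boundary :: "'n::finite current \<Rightarrow> 'n Dn form \<Rightarrow> real" where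
  "boundary T = restrict (\<lambda>\<psi>. T (ext_deriv \<psi>)) (test_forms (CARD('n) - 1))"

text \<open>\<open>T\<close> is integration over the countably \<open>n\<close>-rectifiable set \<open>M\<close> with positive integer
  multiplicity \<open>\<theta>\<close> and orientation \<open>\<xi>\<close>, a unit simple \<open>n\<close>-vector (for the Euclidean structure)
  spanning the approximate tangent plane. Taking \<open>M\<close>, \<open>\<theta>\<close> and \<open>\<xi>\<close> Borel, rather than
  \<open>\<H>\<^sup>n\<close>-measurable, is no restriction: \<open>M\<close> is \<open>\<sigma>\<close>-finite and the data may be changed on null sets.\<close>

definition rectifiable_data ::
  "'n::finite current \<Rightarrow> 'n Dn set \<Rightarrow> ('n Dn \<Rightarrow> nat) \<Rightarrow>
   ('n Dn \<Rightarrow> 'n Dn multivector) \<Rightarrow> bool" where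
  "rectifiable_data T M \<theta> \<xi> \<longleftrightarrow>
     (let n = CARD('n); H = (hausdorff_measure n :: 'n Dn measure) in
       M \<in> sets borel \<and>
       (\<exists>F :: nat \<Rightarrow> real ^ 'n \<Rightarrow> 'n Dn. (\<forall>i. \<exists>L. L-lipschitz_on UNIV (F i)) \<and>
          (AE x in H. x \<in> M \<longrightarrow> x \<in> (\<Union>i. range (F i)))) \<and>
       \<theta> \<in> borel \<rightarrow>\<^sub>M count_space UNIV \<and>
       (\<forall>x\<in>M. \<theta> x > 0) \<and>
       (\<forall>K. compact K \<longrightarrow> (\<integral>\<^sup>+x\<in>M \<inter> K. of_nat (\<theta> x) \<partial>H) < \<infinity>) \<and>
       (\<forall>\<alpha>\<in>covectors n. (\<lambda>x. \<xi> x \<alpha>) \<in> borel_measurable borel) \<and>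
       (AE x in H. x \<in> M \<longrightarrow>
          (\<exists>vs. length vs = n \<and>
             (\<forall>i<n. \<forall>j<n. inner (vs ! i) (vs ! j) = (if i = j then 1 else 0)) \<and>
             approx_tangent_plane n M x (span (set vs)) \<and> \<xi> x = wedge vs)) \<and>
       (\<forall>\<phi>\<in>test_forms n.
          has_bochner_integral H (\<lambda>x. indicator M x * (real (\<theta> x) * \<xi> x (\<phi> x))) (T \<phi>)))"

definition locally_rectifiable :: "'n::finite current \<Rightarrow> bool" where
  "locally_rectifiable T \<longleftrightarrow> (\<exists>M \<theta> \<xi>. rectifiable_data T M \<theta> \<xi>)"


section \<open>Space-like and special Lagrangian planes\<close>

definition split_inner :: "'n::finite Dn \<Rightarrow> 'n Dn \<Rightarrow> real" where
  "split_inner u v = (\<Sum>j\<in>UNIV. DRe (u $ j) * DRe (v $ j) - DIm (u $ j) * DIm (v $ j))"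

definition omega :: "'n::finite Dn \<Rightarrow> 'n Dn \<Rightarrow> real" where
  "omega u v = (\<Sum>j\<in>UNIV. DRe (u $ j) * DIm (v $ j) - DIm (u $ j) * DRe (v $ j))"

text \<open>The coordinates \<open>z\<^sub>1, \<dots>, z\<^sub>n\<close> are indexed by the linearly ordered type \<open>'n\<close>, and the order fixes
  the standard orientation; \<open>pos i\<close> is the position of \<open>i\<close>, so that
  \<open>dz [v\<^sub>1, \<dots>, v\<^sub>n] = (dz\<^sub>1 \<and> \<dots> \<and> dz\<^sub>n)(v\<^sub>1, \<dots>, v\<^sub>n)\<close>.\<close>

definition pos :: "'n::{finite,linorder} \<Rightarrow> nat" where
  "pos i = card {j. j < i}"

definition dz :: "'n::{finite,linorder} Dn list \<Rightarrow> double" where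
  "dz vs = det (\<chi> i j. (vs ! pos i) $ j)"

definition spacelike_plane :: "'n::finite Dn set \<Rightarrow> bool" where
  "spacelike_plane P \<longleftrightarrow> subspace P \<and> dim P = CARD('n) \<and> (\<forall>v\<in>P. v \<noteq> 0 \<longrightarrow> split_inner v v > 0)"

text \<open>\<open>vs\<close> is a \<open>split_inner\<close>-orthonormal basis of \<open>P\<close>, for the orientation of \<open>P\<close> that the projection
  along \<open>\<tau>\<real>\<^sup>n\<close> maps to the standard orientation of \<open>\<real>\<^sup>n\<close>.\<close>

definition pos_orthonormal_basis ::
  "'n::{finite,linorder} Dn set \<Rightarrow> 'n Dn list \<Rightarrow> bool" where
  "pos_orthonormal_basis P vs \<longleftrightarrow> length vs = CARD('n) \<and> span (set vs) = P \<and>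
     (\<forall>i<CARD('n). \<forall>j<CARD('n). split_inner (vs ! i) (vs ! j) = (if i = j then 1 else 0)) \<and>
     det (\<chi> i j. DRe ((vs ! pos i) $ j)) > 0"

definition G_space_plus :: "'n::{finite,linorder} Dn multivector set" where
  "G_space_plus = {wedge vs | P vs. spacelike_plane P \<and> pos_orthonormal_basis P vs}"

definition SLAG :: "'n::{finite,linorder} Dn multivector set" where
  "SLAG = {wedge vs | P vs. spacelike_plane P \<and> pos_orthonormal_basis P vs \<and>
     (\<forall>u\<in>P. \<forall>v\<in>P. omega u v = 0) \<and> DIm (dz vs) = 0}"


section \<open>Positive space-like currents\<close>

text \<open>The plane oriented by \<open>\<xi>\<close> belongs to \<open>G_space_plus\<close> iff \<open>\<xi>\<close> is a positive multiple of an element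
  of \<open>G_space_plus\<close>: the two are normalized with respect to different inner products.\<close>

definition positive_spacelike :: "'n::{finite,linorder} current \<Rightarrow> bool" where
  "positive_spacelike T \<longleftrightarrow> (\<exists>M \<theta> \<xi>. rectifiable_data T M \<theta> \<xi> \<and>
     (AE x in hausdorff_measure CARD('n). x \<in> M \<longrightarrow>
        (\<exists>c>0. \<exists>\<eta>\<in>G_space_plus. \<xi> x = (\<lambda>\<alpha>. c * \<eta> \<alpha>))))"

text \<open>\<open>T(\<phi>) = \<integral> \<phi>(\<tau>) d\<mu>\<close> with \<open>\<mu>\<close> a Radon measure and \<open>\<tau>\<close> in \<open>G_space_plus\<close> almost everywhere.\<close>

definition polar_decomposition ::
  "'n::{finite,linorder} current \<Rightarrow> 'n Dn measure \<Rightarrow>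
   ('n Dn \<Rightarrow> 'n Dn multivector) \<Rightarrow> bool" where
  "polar_decomposition T \<mu> \<tau> \<longleftrightarrow>
     sets \<mu> = sets borel \<and>
     (\<forall>K. compact K \<longrightarrow> emeasure \<mu> K < \<infinity>) \<and>
     (\<forall>\<alpha>\<in>covectors CARD('n). (\<lambda>x. \<tau> x \<alpha>) \<in> borel_measurable borel) \<and>
     (AE x in \<mu>. \<tau> x \<in> G_space_plus) \<and>
     (\<forall>\<phi>\<in>test_forms CARD('n). has_bochner_integral \<mu> (\<lambda>x. \<tau> x (\<phi> x)) (T \<phi>))"

text \<open>For positive space-like \<open>T\<close> the pair \<open>(\<parallel>T\<parallel>, T\<^sup>\<rightarrow>)\<close> exists; \<open>\<parallel>T\<parallel>\<close> is unique, and \<open>T\<^sup>\<rightarrow>\<close> is unique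
  up to \<open>\<parallel>T\<parallel>\<close>-null sets.\<close>

definition polar ::
  "'n::{finite,linorder} current \<Rightarrow>
   'n Dn measure \<times> ('n Dn \<Rightarrow> 'n Dn multivector)" where
  "polar T = (SOME (\<mu>, \<tau>). polar_decomposition T \<mu> \<tau>)"

definition mass_measure :: "'n::{finite,linorder} current \<Rightarrow> 'n Dn measure" where
  "mass_measure T = fst (polar T)"

definition orienting_field ::
  "'n::{finite,linorder} current \<Rightarrow> 'n Dn \<Rightarrow> 'n Dn multivector" where
  "orienting_field T = snd (polar T)"

definition vol :: "'n::{finite,linorder} current \<Rightarrow> ennreal" where
  "vol T = emeasure (mass_measure T) UNIV"

definition split_SLAG :: "'n::{finite,linorder} current \<Rightarrow> bool" where
  "split_SLAG T \<longleftrightarrow> locally_rectifiable T \<and> positive_spacelike T \<and>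
     (AE x in mass_measure T. orienting_field T x \<in> SLAG)"

end

theory Submission
  imports Defs
begin

text \<open>The calibration is the constant form \<open>Re dz\<close>. On a positive space-like plane with orthonormal basis
  \<open>X + \<tau>Y\<close> the determinant \<open>dz\<close> satisfies \<open>(Re dz)\<^sup>2 = (Im dz)\<^sup>2 + det (1 + K)\<close>, where \<open>K\<close> is the
  skew matrix of \<open>\<omega>\<close> in this basis. Since \<open>1 + K\<close> expands lengths, \<open>det (1 + K) \<ge> 1\<close> with equality
  iff \<open>K = 0\<close>; hence \<open>Re dz \<ge> 1\<close>, with equality exactly on special Lagrangian planes. As \<open>Re dz\<close> is
  exact, \<open>T\<close> and \<open>S\<close> take the same value on it (after a cutoff away from the compact supports), and
  this value equals the volume of \<open>T\<close> and bounds that of \<open>S\<close> from above.\<close>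

section \<open>Determinants of expanding matrices\<close>

text \<open>Under the splitting of the double numbers into two copies of the reals,
  \<open>dz\<close> of a frame becomes the pair \<open>det (X + Y)\<close>,
  \<open>det (X - Y)\<close>. \<open>Re dz\<close> is their arithmetic mean and
  \<open>det (1 + K)\<close> their product, so the bound is the inequality of the means once both
  are positive. The orientation enters there, through \<open>det X > 0\<close>.

  The remaining obstacles are analytic. \<open>polar\<close> is a choice, so a polar decomposition
  has to be exhibited. The factor between the Euclidean unit \<open>n\<close>-vector and its
  space-like normalization is given only pointwise, with no measurability, and is therefore replaced
  by an explicit formula in the coordinates of the \<open>n\<close>-vector. Local finiteness of the
  new measure comes from the calibration inequality itself. Supports of currents are defined through
  test forms alone, so it must be shown that the measures are carried by them;
  \<open>\<eta> re_dz \<ge> 1\<close> excludes the cancellation that could spoil this.\<close>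

lemma abs_det_le:
  fixes A :: "real^'n^'n"
  assumes "\<And>i j. \<bar>A $ i $ j\<bar> \<le> b"
  shows "\<bar>det A\<bar> \<le> fact CARD('n) * b ^ CARD('n)"
proof -
  have "\<bar>det A\<bar> \<le> (\<Sum>p\<in>{p. p permutes (UNIV :: 'n set)}.
      \<bar>of_int (sign p) * (\<Prod>i\<in>UNIV. A $ i $ p i)\<bar>)"
    unfolding det_def by (rule sum_abs)
  also have "\<dots> \<le> (\<Sum>p\<in>{p. p permutes (UNIV :: 'n set)}. b ^ CARD('n))"
  proof (rule sum_mono)
    fix p :: "'n \<Rightarrow> 'n"
    have "\<bar>of_int (sign p) * (\<Prod>i\<in>UNIV. A $ i $ p i)\<bar> = (\<Prod>i\<in>UNIV. \<bar>A $ i $ p i\<bar>)"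
      by (simp add: abs_mult abs_prod sign_def)
    also have "\<dots> \<le> (\<Prod>i\<in>(UNIV :: 'n set). b)"
      by (rule prod_mono) (auto simp: assms)
    finally show "\<bar>of_int (sign p) * (\<Prod>i\<in>UNIV. A $ i $ p i)\<bar> \<le> b ^ CARD('n)"
      by simp
  qed
  also have "\<dots> = fact CARD('n) * b ^ CARD('n)"
    by (simp add: card_permutations)
  finally show ?thesis .
qed

text \<open>All powers of a contraction have bounded entries, so the powers of its determinant are
  bounded.\<close>

lemma abs_det_contraction_le_1:
  fixes B :: "real^'n^'n"
  assumes B: "\<And>x. norm (B *v x) \<le> norm x"
  shows "\<bar>det B\<bar> \<le> 1"
proof (rule ccontr)
  assume "\<not> \<bar>det B\<bar> \<le> 1"
  \<comment> \<open>\<open>fact CARD('n)\<close> is the bound of \<open>abs_det_le\<close> for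
    entries of size at most 1.\<close>
  then obtain k where k: "fact CARD('n) < \<bar>det B\<bar> ^ k"
    using real_arch_pow[of "\<bar>det B\<bar>"] by (auto simp: not_le)
  define P where "P = (\<lambda>k. ((**) B ^^ k) (mat 1))"
  have det_P: "det (P j) = det B ^ j" for j
    by (induction j) (simp_all add: P_def det_mul)
  have norm_P: "norm (P j *v x) \<le> norm x" for j x
  proof (induction j)
    case (Suc j)
    have "P (Suc j) *v x = B *v (P j *v x)"
      by (simp add: P_def matrix_vector_mul_assoc)
    then show ?case
      using B[of "P j *v x"] Suc by simp
  qed (simp add: P_def)
  have "\<bar>P k $ i $ j\<bar> \<le> 1" for i j
  proof -
    have "P k $ i $ j = (P k *v axis j 1) $ i"
      by (simp add: matrix_vector_mult_basis column_def)
    then show ?thesis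
      using component_le_norm_cart[of "P k *v axis j 1" i] norm_P[of k "axis j 1"]
      by (simp add: norm_axis_1)
  qed
  then have "\<bar>det (P k)\<bar> \<le> fact CARD('n)"
    using abs_det_le[of "P k" 1] by simp
  with k show False
    by (simp add: det_P power_abs)
qed

text \<open>The kernel is trivial and the inverse is a contraction, so the bound for contractions
  applies to the inverse.\<close>

lemma abs_det_expanding_ge_1:
  fixes A :: "real^'n^'n"
  assumes A: "\<And>x. norm x \<le> norm (A *v x)"
  shows "1 \<le> \<bar>det A\<bar>"
proof -
  have "A *v x = 0 \<Longrightarrow> x = 0" for x
    using A[of x] by simp
  then obtain B where B: "B ** A = mat 1"
    using matrix_left_invertible_ker[of A] by blast
  then have AB: "A ** B = mat 1"
    by (simp add: matrix_left_right_inverse)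
  have "norm (B *v x) \<le> norm x" for x
    using A[of "B *v x"] by (simp add: matrix_vector_mul_assoc AB)
  then have "\<bar>det B\<bar> \<le> 1"
    by (rule abs_det_contraction_le_1)
  moreover have "\<bar>det B\<bar> * \<bar>det A\<bar> = 1"
    using arg_cong[OF B, of det] by (simp add: det_mul flip: abs_mult)
  ultimately show ?thesis
    using mult_right_mono[of "\<bar>det B\<bar>" 1 "\<bar>det A\<bar>"] by simp
qed

text \<open>After a rotation taking \<open>w\<close> to a multiple of a basis vector, \<open>A\<close> expands more than a
  diagonal matrix of determinant greater than 1.\<close>

lemma abs_det_expanding_gt_1:
  fixes A :: "real^'n^'n"
  assumes A: "\<And>x. (norm x)\<^sup>2 + (inner w x)\<^sup>2 \<le> (norm (A *v x))\<^sup>2" and w: "w \<noteq> 0"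
  shows "1 < \<bar>det A\<bar>"
proof -
  fix k :: 'n
  have "norm (norm w *\<^sub>R axis k 1 :: real^'n) = norm w"
    by (simp add: norm_axis_1)
  then obtain f :: "real^'n \<Rightarrow> real^'n"
    where f: "orthogonal_transformation f" "f (norm w *\<^sub>R axis k 1) = w"
    by (rule orthogonal_transformation_exists)
  define R where "R = matrix f"
  have R: "R *v x = f x" for x
    unfolding R_def
    by (rule fun_cong[OF matrix_vector_mul(2)[OF orthogonal_transformation_linear[OF f(1)]]])
  have detR: "\<bar>det R\<bar> = 1"
    unfolding R_def using f(1) by (rule orthogonal_transformation_det)
  \<comment> \<open>Chosen so that \<open>D s\<close> stretches the \<open>k\<close>-axis exactly as
    much as the hypothesis guarantees for \<open>A\<close> along \<open>w\<close>, that is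
    \<open>s\<^sup>2 - 1 = (norm w)\<^sup>2\<close>.\<close>
  define s where "s = sqrt (1 + (norm w)\<^sup>2)"
  have s: "s > 1"
    unfolding s_def using w by simp
  define D :: "real \<Rightarrow> real^'n^'n" where "D = (\<lambda>c. \<chi> i j. if i = j then (if i = k then c else 1) else 0)"
  have D: "D c *v x = (\<chi> i. if i = k then c * x $ i else x $ i)" for c x
    by (simp add: D_def matrix_vector_mult_def vec_eq_iff if_distrib[of "\<lambda>t. t * _"]
        sum.delta' cong: if_cong)
  have detD: "det (D c) = c" for c
    by (subst det_diagonal) (auto simp: D_def prod.delta)
  have norm_D: "(norm (D s *v x))\<^sup>2 = (norm x)\<^sup>2 + (norm w)\<^sup>2 * (x $ k)\<^sup>2" for x
  proof -
    have "(norm (D s *v x))\<^sup>2 = (\<Sum>i\<in>UNIV. (x $ i)\<^sup>2 + (if i = k then (norm w)\<^sup>2 * (x $ k)\<^sup>2 else 0))"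
      unfolding norm_vec_def[of "D s *v x"] L2_set_def
      by (subst real_sqrt_pow2)
        (auto intro!: sum_nonneg sum.cong simp: D s_def power_mult_distrib algebra_simps)
    also have "\<dots> = (norm x)\<^sup>2 + (norm w)\<^sup>2 * (x $ k)\<^sup>2"
      by (simp add: norm_vec_def[of x] L2_set_def sum.distrib sum_nonneg)
    finally show ?thesis .
  qed
  \<comment> \<open>\<open>D (1 / s)\<close> uses up the surplus stretching. What is left is still
    expanding, so \<open>\<bar>det A\<bar> = s * \<bar>det C\<bar> \<ge> s\<close>.\<close>
  define C where "C = A ** R ** D (1 / s)"
  have "norm x \<le> norm (C *v x)" for x
  proof -
    define y where "y = D (1 / s) *v x"
    have x: "x = D s *v y"
      using s by (simp add: y_def D vec_eq_iff)
    have "inner w (R *v y) = norm w * y $ k"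
    proof -
      have "inner w (R *v y) = inner (f (norm w *\<^sub>R axis k 1)) (f y)"
        by (simp add: R f(2))
      also have "\<dots> = inner (norm w *\<^sub>R axis k 1) y"
        using f(1) by (simp add: orthogonal_transformation_def)
      finally show ?thesis
        by (simp add: inner_axis')
    qed
    moreover have "norm (R *v y) = norm y"
      using f(1) by (simp add: R orthogonal_transformation_norm)
    ultimately have "(norm x)\<^sup>2 \<le> (norm (A *v (R *v y)))\<^sup>2"
      using A[of "R *v y"] by (simp add: x norm_D power_mult_distrib)
    also have "A *v (R *v y) = C *v x"
      by (simp add: C_def y_def matrix_vector_mul_assoc matrix_mul_assoc)
    finally show ?thesis
      by (simp add: power2_le_iff_abs_le)
  qed
  then have "1 \<le> \<bar>det C\<bar>"
    by (rule abs_det_expanding_ge_1)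
  also have "\<bar>det C\<bar> = \<bar>det A\<bar> / s"
    using s by (simp add: C_def det_mul abs_mult detR detD)
  finally show ?thesis
    using s by (simp add: field_simps)
qed

text \<open>The cross term \<open>2 * inner x (K *v x)\<close> vanishes because a skew form is zero
  on the diagonal.\<close>

lemma norm_one_plus_skew:
  fixes K :: "real^'n^'n"
  assumes skew: "transpose K = - K"
  shows "(norm ((mat 1 + K) *v x))\<^sup>2 = (norm x)\<^sup>2 + (norm (K *v x))\<^sup>2"
proof -
  have "inner x (K *v x) = inner (transpose K *v x) x"
    by (simp add: dot_lmul_matrix)
  also have "\<dots> = - inner x (K *v x)"
    by (simp add: skew matrix_vector_mult_def inner_vec_def sum_negf mult.commute)
  finally have "inner x (K *v x) = 0"
    by simp
  then show ?thesis
    by (simp add: matrix_vector_mult_add_rdistrib power2_norm_eq_inner inner_add_left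
        inner_add_right inner_commute)
qed

lemma abs_det_one_plus_skew_ge_1:
  fixes K :: "real^'n^'n"
  assumes "transpose K = - K"
  shows "1 \<le> \<bar>det (mat 1 + K)\<bar>"
proof (rule abs_det_expanding_ge_1)
  fix x
  have "(norm x)\<^sup>2 \<le> (norm ((mat 1 + K) *v x))\<^sup>2"
    using norm_one_plus_skew[OF assms, of x] by simp
  then show "norm x \<le> norm ((mat 1 + K) *v x)"
    by (simp add: power2_le_iff_abs_le)
qed

text \<open>A nonzero row of \<open>K\<close> can serve as the vector \<open>w\<close> of
  \<open>abs_det_expanding_gt_1\<close>, since a component of \<open>K *v x\<close> is at most its
  norm.\<close>

lemma abs_det_one_plus_skew_eq_1:
  fixes K :: "real^'n^'n"
  assumes skew: "transpose K = - K" and det: "\<bar>det (mat 1 + K)\<bar> = 1"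
  shows "K = 0"
proof (rule ccontr)
  assume "K \<noteq> 0"
  then obtain i where "K $ i \<noteq> 0"
    by (auto simp: vec_eq_iff)
  moreover have "(norm x)\<^sup>2 + (inner (K $ i) x)\<^sup>2 \<le> (norm ((mat 1 + K) *v x))\<^sup>2" for x
  proof -
    have "\<bar>inner (K $ i) x\<bar> \<le> norm (K *v x)"
      using component_le_norm_cart[of "K *v x" i] by (simp add: matrix_vector_mul_component)
    then have "\<bar>inner (K $ i) x\<bar>\<^sup>2 \<le> (norm (K *v x))\<^sup>2"
      by (intro power_mono) auto
    then show ?thesis
      using norm_one_plus_skew[OF skew, of x] by simp
  qed
  ultimately have "1 < \<bar>det (mat 1 + K)\<bar>"
    by (intro abs_det_expanding_gt_1)
  with det show False
    by simp
qed

section \<open>Space-like frames as pairs of real matrices\<close>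

text \<open>The rows of \<open>X + \<tau>Y\<close> are orthonormal for the split form iff \<open>XX\<^sup>t - YY\<^sup>t = 1\<close>. The matrices
  \<open>X + sY\<close> with \<open>\<bar>s\<bar> \<le> 1\<close> are then invertible, so their determinants have the sign of \<open>det X\<close>.\<close>

lemma det_spacelike_pos:
  fixes X Y :: "real^'n^'n"
  assumes XY: "X ** transpose X - Y ** transpose Y = mat 1" and X: "det X > 0" and s: "\<bar>s\<bar> \<le> 1"
  shows "det (X + s *\<^sub>R Y) > 0"
proof -
  have nz: "det (X + t *\<^sub>R Y) \<noteq> 0" if "\<bar>t\<bar> \<le> 1" for t
  proof
    assume "det (X + t *\<^sub>R Y) = 0"
    then have "\<not> invertible (transpose (X + t *\<^sub>R Y))"
      by (simp only: invertible_det_nz det_transpose)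
    \<comment> \<open>The condition on \<open>X\<close> and \<open>Y\<close> concerns rows, hence
      the transpose. A kernel vector \<open>u\<close> makes the norm of
      \<open>transpose X *v u\<close> at most that of \<open>transpose Y *v u\<close>, while the
      difference of their squares is \<open>inner u u > 0\<close>.\<close>
    then obtain u where u: "u \<noteq> 0" "transpose (X + t *\<^sub>R Y) *v u = 0"
      by (metis invertible_left_inverse matrix_left_invertible_ker)
    let ?a = "transpose X *v u" and ?b = "transpose Y *v u"
    have tr: "transpose (X + t *\<^sub>R Y) = transpose X + t *\<^sub>R transpose Y"
      by (simp add: transpose_def vec_eq_iff)
    have "transpose (X + t *\<^sub>R Y) *v u = ?a + t *\<^sub>R ?b"
      unfolding tr matrix_vector_mult_add_rdistrib
      by (simp add: scaleR_matrix_vector_assoc[symmetric] del: transpose_matrix_vector)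
    with u(2) have "?a = - (t *\<^sub>R ?b)"
      by (simp add: eq_neg_iff_add_eq_0)
    then have "norm ?a = \<bar>t\<bar> * norm ?b"
      by simp
    also have "\<dots> \<le> norm ?b"
      using that mult_right_mono[of "\<bar>t\<bar>" 1 "norm ?b"] by simp
    finally have "(norm ?a)\<^sup>2 \<le> (norm ?b)\<^sup>2"
      by (intro power_mono) auto
    moreover have n: "(norm (transpose Z *v u))\<^sup>2 = inner u ((Z ** transpose Z) *v u)" for Z :: "real^'n^'n"
      by (simp add: power2_norm_eq_inner matrix_vector_mul_assoc[symmetric] dot_lmul_matrix)
    have "(norm ?a)\<^sup>2 - (norm ?b)\<^sup>2 = inner u ((X ** transpose X - Y ** transpose Y) *v u)"
      unfolding n by (simp add: matrix_vector_mult_diff_rdistrib inner_diff_right)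
    then have "(norm ?a)\<^sup>2 - (norm ?b)\<^sup>2 = inner u u"
      by (simp add: XY)
    moreover have "inner u u > 0"
      using u(1) by simp
    ultimately show False
      by linarith
  qed
  have cont: "continuous_on UNIV (\<lambda>t. det (X + t *\<^sub>R Y))"
    unfolding det_def by (auto intro!: continuous_intros)
  show ?thesis
  proof (rule ccontr)
    assume "\<not> ?thesis"
    then have le: "det (X + s *\<^sub>R Y) \<le> 0"
      by simp
    have conn: "connected ((\<lambda>t. det (X + t *\<^sub>R Y)) ` {-1..1})"
      by (intro connected_continuous_image continuous_on_subset[OF cont]) auto
    have "0 \<in> (\<lambda>t. det (X + t *\<^sub>R Y)) ` {-1..1}"
    proof (rule connectedD_interval[OF conn])
      show "det (X + s *\<^sub>R Y) \<in> (\<lambda>t. det (X + t *\<^sub>R Y)) ` {-1..1}"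
        using s by (intro imageI) (simp add: abs_le_iff)
      show "det X \<in> (\<lambda>t. det (X + t *\<^sub>R Y)) ` {-1..1}"
        by (rule image_eqI[of _ _ 0]) auto
    qed (use le X in auto)
    with nz show False
      by (auto simp: abs_le_iff)
  qed
qed

text \<open>In the product of \<open>X + Y\<close> with the transpose of \<open>X - Y\<close>, the
  pure terms give the identity and the mixed terms a skew matrix.\<close>

lemma spacelike_det_product:
  fixes X Y :: "real^'n^'n"
  assumes "X ** transpose X - Y ** transpose Y = mat 1"
  shows "det (X + Y) * det (X - Y) = det (mat 1 + (Y ** transpose X - X ** transpose Y))"
proof -
  have "det (X + Y) * det (X - Y) = det ((X + Y) ** transpose (X - Y))"
    by (simp add: det_mul det_transpose)
  also have "transpose (X - Y) = transpose X - transpose Y"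
    by (simp add: transpose_def vec_eq_iff)
  also have "(X + Y) ** (transpose X - transpose Y) = 
      X ** transpose X - Y ** transpose Y + (Y ** transpose X - X ** transpose Y)"
    by (simp add: vec_eq_iff matrix_matrix_mult_def algebra_simps sum.distrib sum_subtractf)
  finally show ?thesis
    by (simp add: assms)
qed

section \<open>Smooth functions\<close>

lemma C_k_SucI:
  assumes f: "\<And>x. (f has_derivative f' x) (at x)" and f': "\<And>v. C_k k (\<lambda>x. f' x v)"
  shows "C_k (Suc k) f"
proof -
  have "frechet_derivative f (at x) = f' x" for x
    using frechet_derivative_at[OF f] by simp
  then show ?thesis
    using f f' by (auto simp: differentiable_on_def differentiable_def)
qed

lemma C_k_Suc_has_derivative:
  "C_k (Suc k) f \<Longrightarrow> (f has_derivative frechet_derivative f (at x)) (at x)"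
  by (simp add: differentiable_on_def frechet_derivative_works)

lemma C_k_SucD: "C_k (Suc k) f \<Longrightarrow> C_k k f"
proof (induction k arbitrary: f)
  case 0
  then show ?case
    by (simp add: differentiable_imp_continuous_on)
next
  case (Suc k)
  then show ?case
    by (metis C_k.simps(2))
qed

lemma C_k_const: "C_k k (\<lambda>_. c)"
proof (induction k arbitrary: c)
  case (Suc k)
  then show ?case
    by (intro C_k_SucI[where f' = "\<lambda>_ _. 0"]) auto
qed simp

lemma C_k_bounded_linear:
  assumes "bounded_linear f"
  shows "C_k k f"
proof (cases k)
  case 0
  then show ?thesis
    using assms by (simp add: linear_continuous_on)
next
  case (Suc k')
  then show ?thesis
    unfolding Suc using assms
    by (intro C_k_SucI[where f' = "\<lambda>_. f"] bounded_linear_imp_has_derivative C_k_const)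
qed

lemma C_k_add: "C_k k f \<Longrightarrow> C_k k g \<Longrightarrow> C_k k (\<lambda>x. f x + g x)"
proof (induction k arbitrary: f g)
  case (Suc k)
  show ?case
    by (rule C_k_SucI[OF has_derivative_add[OF Suc.prems[THEN C_k_Suc_has_derivative]]])
      (use Suc in auto)
qed (simp add: continuous_on_add)

lemma C_k_mult:
  fixes f g :: "'v::real_normed_vector \<Rightarrow> real"
  shows "C_k k f \<Longrightarrow> C_k k g \<Longrightarrow> C_k k (\<lambda>x. f x * g x)"
proof (induction k arbitrary: f g)
  case (Suc k)
  show ?case
    by (rule C_k_SucI[OF has_derivative_mult[OF Suc.prems[THEN C_k_Suc_has_derivative]]])
      (use Suc Suc.prems[THEN C_k_SucD] in \<open>auto intro!: C_k_add Suc.IH\<close>)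
qed (simp add: continuous_on_mult)

lemma C_k_sum: "(\<And>i. i \<in> I \<Longrightarrow> C_k k (f i)) \<Longrightarrow> C_k k (\<lambda>x. \<Sum>i\<in>I. f i x)"
  by (induction I rule: infinite_finite_induct) (auto intro: C_k_const C_k_add)

lemma C_k_diff: "C_k k f \<Longrightarrow> C_k k g \<Longrightarrow> C_k k (\<lambda>x. f x - g x)"
  using C_k_add[of k f "\<lambda>x. - 1 * g x"] C_k_mult[OF C_k_const[of k "- 1"], of g] by simp

lemma C_k_inverse:
  fixes f :: "'v::real_normed_vector \<Rightarrow> real"
  assumes "\<And>x. f x \<noteq> 0"
  shows "C_k k f \<Longrightarrow> C_k k (\<lambda>x. inverse (f x))"
proof (induction k)
  case (Suc k)
  have f: "C_k k f" and f': "\<And>v. C_k k (\<lambda>x. frechet_derivative f (at x) v)"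
    using Suc.prems C_k_SucD by auto
  have *: "C_k k (\<lambda>x. inverse (f x))"
    using Suc.IH f .
  have "C_k k (\<lambda>x. - 1 * (inverse (f x) * frechet_derivative f (at x) v * inverse (f x)))" for v
    by (intro C_k_mult C_k_const * f')
  then show ?case
    by (intro C_k_SucI[OF Deriv.has_derivative_inverse[OF assms C_k_Suc_has_derivative[OF Suc.prems]]]) simp
qed (use assms in \<open>simp add: continuous_on_inverse\<close>)

lemma C_k_inner_self: "C_k k (\<lambda>x::'v::real_inner. inner x x)"
proof (cases k)
  case (Suc k')
  have "C_k k' (\<lambda>x::'v. inner x v + inner v x)" for v
    by (intro C_k_add C_k_bounded_linear bounded_linear_inner_left bounded_linear_inner_right)
  moreover have "((\<lambda>x::'v. inner x x) has_derivative (\<lambda>v. inner x v + inner v x)) (at x)" for x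
    using has_derivative_inner[OF has_derivative_ident has_derivative_ident] .
  ultimately show ?thesis
    unfolding Suc by (intro C_k_SucI)
qed (simp add: continuous_on_inner)

text \<open>With \<open>s = 1/t\<close> these are the functions \<open>s^j * exp (-s)\<close>,
  extended by 0. The derivative of one member is a combination of the members of index
  \<open>j + 1\<close> and \<open>j + 2\<close>, so smoothness of all of them follows by one
  induction on the order with \<open>j\<close> arbitrary.\<close>

definition flat_exp :: "nat \<Rightarrow> real \<Rightarrow> real" where
  "flat_exp j t = (if t > 0 then inverse t ^ j * exp (- inverse t) else 0)"

lemma flat_exp_nonneg: "0 \<le> flat_exp j t"
  by (simp add: flat_exp_def)

lemma flat_exp_pos: "t > 0 \<Longrightarrow> 0 < flat_exp j t"
  by (simp add: flat_exp_def)

lemma flat_exp_eq_0: "t \<le> 0 \<Longrightarrow> flat_exp j t = 0"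
  by (simp add: flat_exp_def)

lemma tendsto_flat_exp_0: "(flat_exp j \<longlongrightarrow> 0) (at 0)"
proof -
  have "((\<lambda>t. inverse t ^ j / exp (inverse t)) \<longlongrightarrow> 0) (at_right (0::real))"
    by (rule filterlim_compose[OF tendsto_power_div_exp_0 filterlim_inverse_at_top_right])
  then have "(flat_exp j \<longlongrightarrow> 0) (at_right 0)"
    by (rule tendsto_cong[THEN iffD1, rotated])
      (auto simp: flat_exp_def eventually_at_filter exp_minus divide_inverse intro!: always_eventually)
  moreover have "(flat_exp j \<longlongrightarrow> 0) (at_left 0)"
    by (rule tendsto_eventually) (auto simp: flat_exp_def eventually_at_filter)
  ultimately show ?thesis
    by (simp add: filterlim_split_at)
qed

lemma flat_exp_has_derivative:
  "(flat_exp j has_real_derivative flat_exp (j + 2) t - j * flat_exp (j + 1) t) (at t)"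
proof (cases t "0 :: real" rule: linorder_cases)
  case greater
  have "((\<lambda>t. inverse t ^ j * exp (- inverse t)) has_real_derivative
      (real j * inverse t ^ (j - 1) * - (inverse t)\<^sup>2) * exp (- inverse t) +
      inverse t ^ j * (exp (- inverse t) * (inverse t)\<^sup>2)) (at t)"
    using greater by (auto intro!: derivative_eq_intros simp: power2_eq_square)
  also have "(real j * inverse t ^ (j - 1) * - (inverse t)\<^sup>2) * exp (- inverse t) +
      inverse t ^ j * (exp (- inverse t) * (inverse t)\<^sup>2) =
      flat_exp (j + 2) t - j * flat_exp (j + 1) t"
    using greater by (cases j) (simp_all add: flat_exp_def power2_eq_square)
  finally have "((\<lambda>t. inverse t ^ j * exp (- inverse t)) has_real_derivative
      flat_exp (j + 2) t - j * flat_exp (j + 1) t) (at t)" .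
  then show ?thesis
    by (rule DERIV_cong_ev[THEN iffD1, rotated -1])
      (use greater in \<open>auto simp: flat_exp_def eventually_nhds intro!: exI[of _ "{0<..}"]\<close>)
next
  case less
  have "((\<lambda>t. 0) has_real_derivative 0) (at t)"
    by simp
  then show ?thesis
    by (rule DERIV_cong_ev[THEN iffD1, rotated -1])
      (use less in \<open>auto simp: flat_exp_def eventually_nhds intro!: exI[of _ "{..<0}"]\<close>)
next
  case equal
  \<comment> \<open>The difference quotient at 0 is the next member of the family, which tends to
    0.\<close>
  have "flat_exp j h / h = flat_exp (Suc j) h" for h
    by (simp add: flat_exp_def field_simps)
  then show ?thesis
    using tendsto_flat_exp_0[of "Suc j"] equal by (simp add: DERIV_def flat_exp_eq_0)
qed

lemma C_k_flat_exp: "C_k k f \<Longrightarrow> C_k k (\<lambda>x. flat_exp j (f x))"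
proof (induction k arbitrary: j)
  case 0
  have "continuous_on UNIV (flat_exp j)"
    using flat_exp_has_derivative DERIV_continuous by (metis continuous_at_imp_continuous_on)
  then show ?case
    using 0 by (auto intro: continuous_on_compose2)
next
  case (Suc k)
  have f: "C_k k f" and f': "\<And>v. C_k k (\<lambda>x. frechet_derivative f (at x) v)"
    using Suc.prems C_k_SucD by auto
  show ?case
  proof (rule C_k_SucI)
    show "((\<lambda>x. flat_exp j (f x)) has_derivative
      (\<lambda>v. (flat_exp (j + 2) (f x) - j * flat_exp (j + 1) (f x)) * frechet_derivative f (at x) v)) (at x)" for x
      using has_derivative_compose[OF C_k_Suc_has_derivative[OF Suc.prems]
          flat_exp_has_derivative[unfolded has_field_derivative_def]] .
    show "C_k k (\<lambda>x. (flat_exp (j + 2) (f x) - j * flat_exp (j + 1) (f x)) * frechet_derivative f (at x) v)" for v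
      by (intro C_k_mult C_k_diff C_k_const f' Suc.IH f)
  qed
qed

text \<open>Nonvanishing on the whole ball matters: later a vanishing integral against the bump must
  force the ball to be a null set.\<close>

lemma exists_smooth_bump:
  fixes a :: "'v::real_inner"
  assumes "r > 0"
  obtains f where "\<And>k. C_k k f" "\<And>x. 0 \<le> f x" "\<And>x. f x \<noteq> 0 \<longleftrightarrow> x \<in> ball a r"
proof
  \<comment> \<open>The squared distance is expanded so that it is built from
    \<open>inner x x\<close>, a linear map and constants, to which the closure rules of
    \<open>C_k\<close> apply.\<close>
  let ?f = "\<lambda>x. flat_exp 0 (r\<^sup>2 - (inner x x - 2 * inner a x + inner a a))"
  have *: "inner x x - 2 * inner a x + inner a a = (dist a x)\<^sup>2" for x
    by (simp add: dist_norm power2_norm_eq_inner inner_diff_left inner_diff_right inner_commute)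
  show "C_k k ?f" for k
    by (intro C_k_flat_exp C_k_diff C_k_add C_k_mult C_k_const C_k_inner_self
        C_k_bounded_linear bounded_linear_inner_right)
  show "0 \<le> ?f x" for x
    by (rule flat_exp_nonneg)
  show "?f x \<noteq> 0 \<longleftrightarrow> x \<in> ball a r" for x
  proof -
    have "?f x \<noteq> 0 \<longleftrightarrow> (dist a x)\<^sup>2 < r\<^sup>2"
      unfolding * by (simp add: flat_exp_def)
    also have "\<dots> \<longleftrightarrow> dist a x < r"
      using assms by (simp add: not_le[symmetric] power_mono_iff)
    finally show ?thesis
      by simp
  qed
qed

lemma exists_smooth_cutoff:
  assumes r: "0 \<le> r" "r < R"
  obtains f :: "'v::real_inner \<Rightarrow> real"
    where "\<And>k. C_k k f" "\<And>x. x \<in> cball 0 r \<Longrightarrow> f x = 1" "\<And>x. x \<notin> cball 0 R \<Longrightarrow> f x = 0"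
proof
  let ?g = "\<lambda>x::'v. flat_exp 0 (R\<^sup>2 - inner x x)"
  let ?h = "\<lambda>x::'v. flat_exp 0 (inner x x - r\<^sup>2)"
  \<comment> \<open>\<open>?g\<close> is positive for \<open>norm x < R\<close> and
    \<open>?h\<close> for \<open>norm x > r\<close>. As \<open>r < R\<close>, one of them is
    positive everywhere, so the denominator has no zero.\<close>
  let ?f = "\<lambda>x. ?g x * inverse (?g x + ?h x)"
  have "r\<^sup>2 < R\<^sup>2"
    using r by (simp add: power_strict_mono)
  then have pos: "?g x + ?h x \<noteq> 0" for x
    using flat_exp_pos[of "R\<^sup>2 - inner x x" 0] flat_exp_pos[of "inner x x - r\<^sup>2" 0]
      flat_exp_nonneg[of 0 "R\<^sup>2 - inner x x"] flat_exp_nonneg[of 0 "inner x x - r\<^sup>2"]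
    by (cases "inner x x < R\<^sup>2") force+
  show "C_k k ?f" for k
    by (intro C_k_mult C_k_inverse C_k_flat_exp C_k_add C_k_diff C_k_const C_k_inner_self pos)
  show "?f x = 1" if "x \<in> cball 0 r" for x
  proof -
    have "inner x x \<le> r\<^sup>2"
      using that power_mono[of "norm x" r 2] by (simp add: power2_norm_eq_inner)
    then have "?h x = 0"
      by (simp add: flat_exp_eq_0)
    with pos[of x] show ?thesis
      by simp
  qed
  show "?f x = 0" if "x \<notin> cball 0 R" for x
  proof -
    have "inner x x \<ge> R\<^sup>2"
      using that r power_mono[of R "norm x" 2] by (simp add: power2_norm_eq_inner)
    then show ?thesis
      by (simp add: flat_exp_eq_0)
  qed
qed

section \<open>Alternating forms and the exterior derivative\<close>

lemma linear_mult_const: "linear f \<Longrightarrow> linear (\<lambda>v. c * f v)" for f :: "'v::real_vector \<Rightarrow> real"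
  by (auto intro!: linearI simp: linear_add linear_scale algebra_simps)

lemma linear_mult_const': "linear f \<Longrightarrow> linear (\<lambda>v. f v * c)" for f :: "'v::real_vector \<Rightarrow> real"
  by (auto intro!: linearI simp: linear_add linear_scale algebra_simps)

text \<open>Splittings \<open>xs @ v # ys\<close> replace the updates and indices of
  \<open>covectors\<close>, which suits forms that insert or delete list entries.\<close>

lemma covectorsI:
  assumes len: "\<And>vs. length vs \<noteq> k \<Longrightarrow> \<alpha> vs = 0"
    and lin: "\<And>xs ys. Suc (length xs + length ys) = k \<Longrightarrow> linear (\<lambda>v. \<alpha> (xs @ v # ys))"
    and alt: "\<And>xs ys zs a. Suc (Suc (length xs + length ys + length zs)) = k \<Longrightarrow>
      \<alpha> (xs @ a # ys @ a # zs) = 0"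
  shows "\<alpha> \<in> covectors k"
  unfolding covectors_def
proof (intro CollectI conjI allI impI)
  fix vs :: "'a list" and i
  assume i: "length vs = k" "i < k"
  have "vs[i := v] = take i vs @ v # drop (Suc i) vs" for v
    using i by (simp add: upd_conv_take_nth_drop)
  moreover have "linear (\<lambda>v. \<alpha> (take i vs @ v # drop (Suc i) vs))"
    using i by (intro lin) simp
  ultimately show "linear (\<lambda>v. \<alpha> (vs[i := v]))"
    by simp
next
  fix vs :: "'a list" and i j
  assume ij: "length vs = k" "i < j" "j < k" "vs ! i = vs ! j"
  have "vs = take j vs @ vs ! j # drop (Suc j) vs"
    using ij by (simp add: id_take_nth_drop)
  moreover have "take j vs = take i (take j vs) @ take j vs ! i # drop (Suc i) (take j vs)"
    using ij by (intro id_take_nth_drop) simp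
  moreover have "take j vs ! i = vs ! j"
    using ij by simp
  ultimately have vs: "vs = take i (take j vs) @ vs ! j # drop (Suc i) (take j vs) @ vs ! j # drop (Suc j) vs"
    by (metis append_assoc append_Cons)
  have "\<alpha> (take i (take j vs) @ vs ! j # drop (Suc i) (take j vs) @ vs ! j # drop (Suc j) vs) = 0"
    by (rule alt) (use ij in simp)
  then show "\<alpha> vs = 0"
    using vs by simp
qed (rule len)

lemma covectors_length: "\<alpha> \<in> covectors k \<Longrightarrow> length vs \<noteq> k \<Longrightarrow> \<alpha> vs = 0"
  by (simp add: covectors_def)

lemma covectors_linear:
  assumes "\<alpha> \<in> covectors k" "Suc (length xs + length ys) = k"
  shows "linear (\<lambda>v. \<alpha> (xs @ v # ys))"
proof -
  have "length vs = k \<Longrightarrow> i < k \<Longrightarrow> linear (\<lambda>v. \<alpha> (vs[i := v]))" for vs i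
    using assms(1) by (simp add: covectors_def)
  from this[of "xs @ 0 # ys" "length xs"] show ?thesis
    using assms(2) by simp
qed

lemma covectors_alternating:
  assumes "\<alpha> \<in> covectors k"
  shows "\<alpha> (xs @ a # ys @ a # zs) = 0"
proof (cases "length (xs @ a # ys @ a # zs) = k")
  case True
  have "length vs = k \<Longrightarrow> i < j \<Longrightarrow> j < k \<Longrightarrow> vs ! i = vs ! j \<Longrightarrow> \<alpha> vs = 0" for vs i j
    using assms by (simp add: covectors_def)
  from this[of _ "length xs" "Suc (length xs + length ys)"] show ?thesis
    using True by (auto simp: nth_append)
qed (use assms covectors_length in blast)

lemma covectors_swap:
  assumes \<alpha>: "\<alpha> \<in> covectors k"
  shows "\<alpha> (xs @ a # b # ys) = - \<alpha> (xs @ b # a # ys)"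
proof (cases "Suc (Suc (length xs + length ys)) = k")
  case True
  have l1: "linear (\<lambda>u. \<alpha> (xs @ u # v # ys))" for v
    using True by (intro covectors_linear[OF \<alpha>]) simp
  have l2: "linear (\<lambda>v. \<alpha> (xs @ u # v # ys))" for u
    using covectors_linear[OF \<alpha>, of "xs @ [u]" ys] True by simp
  have "\<alpha> (xs @ u # u # ys) = 0" for u
    using covectors_alternating[OF \<alpha>, of xs u "[]" ys] by simp
  from this[of "a + b"] this[of a] this[of b] show ?thesis
    by (simp add: linear_add[OF l1] linear_add[OF l2])
qed (use covectors_length[OF \<alpha>] in simp)

lemma covectors_move:
  assumes \<alpha>: "\<alpha> \<in> covectors k"
  shows "\<alpha> (xs @ a # ys @ zs) = (-1) ^ length ys * \<alpha> (xs @ ys @ a # zs)"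
proof (induction ys arbitrary: xs)
  case (Cons y ys)
  have "\<alpha> (xs @ a # (y # ys) @ zs) = - \<alpha> ((xs @ [y]) @ a # ys @ zs)"
    using covectors_swap[OF \<alpha>, of xs a y "ys @ zs"] by simp
  also have "\<dots> = (-1) ^ length (y # ys) * \<alpha> (xs @ (y # ys) @ a # zs)"
    by (subst Cons) simp
  finally show ?case .
qed simp

lemma covectors_add:
  "\<alpha> \<in> covectors k \<Longrightarrow> \<beta> \<in> covectors k \<Longrightarrow> (\<lambda>vs. \<alpha> vs + \<beta> vs) \<in> covectors k"
  by (simp add: covectors_def linear_compose_add)

lemma covectors_scale: "\<alpha> \<in> covectors k \<Longrightarrow> (\<lambda>vs. c * \<alpha> vs) \<in> covectors k"
  by (simp add: covectors_def linear_mult_const)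

lemma covectors_contract:
  assumes "\<alpha> \<in> covectors (Suc k)"
  shows "(\<lambda>vs. \<alpha> (x # vs)) \<in> covectors k"
proof (rule covectorsI)
  show "linear (\<lambda>v. \<alpha> (x # xs @ v # ys))" if "Suc (length xs + length ys) = k" for xs ys
    using covectors_linear[OF assms, of "x # xs" ys] that by simp
  show "\<alpha> (x # xs @ a # ys @ a # zs) = 0" for xs ys zs a
    using covectors_alternating[OF assms, of "x # xs"] by simp
qed (use assms covectors_length in force)

text \<open>The wedge product of the one-form \<open>L\<close> with \<open>\<beta>\<close>,
  normalized as in \<open>ext_deriv\<close>. It is the shape of the term in which the derivative
  falls on a cutoff.\<close>

definition wedge_left :: "('v \<Rightarrow> real) \<Rightarrow> ('v list \<Rightarrow> real) \<Rightarrow> 'v list \<Rightarrow> real" where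
  "wedge_left L \<beta> vs = (\<Sum>i<length vs. (-1) ^ i * (L (vs ! i) * \<beta> (take i vs @ drop (Suc i) vs)))"

text \<open>Linearity in one entry depends on whether the deleted position lies before it, at it or
  after it. If two entries agree, deleting a third one leaves both copies, so only the deletions of
  the two copies survive, and these cancel.\<close>

lemma wedge_left_in_covectors:
  assumes L: "linear L" and \<beta>: "\<beta> \<in> covectors k"
  shows "wedge_left L \<beta> \<in> covectors (Suc k)"
proof (rule covectorsI)
  fix vs :: "'a list"
  assume "length vs \<noteq> Suc k"
  then show "wedge_left L \<beta> vs = 0"
    unfolding wedge_left_def by (intro sum.neutral) (auto simp: covectors_length[OF \<beta>])
next
  fix xs ys :: "'a list"
  assume len: "Suc (length xs + length ys) = Suc k"
  define t where "t = (\<lambda>v i. L ((xs @ v # ys) ! i) *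
      \<beta> (take i (xs @ v # ys) @ drop (Suc i) (xs @ v # ys)))"
  have "linear (\<lambda>v. t v i)" if i: "i < Suc k" for i
  proof (cases i "length xs" rule: linorder_cases)
    case less
    then have "t v i = L (xs ! i) * \<beta> ((take i xs @ drop (Suc i) xs) @ v # ys)" for v
      by (simp add: t_def nth_append)
    moreover have "linear (\<lambda>v. \<beta> ((take i xs @ drop (Suc i) xs) @ v # ys))"
      using less len by (intro covectors_linear[OF \<beta>]) simp
    ultimately show ?thesis
      by (simp only: linear_mult_const)
  next
    case equal
    then have "t v i = L v * \<beta> (xs @ ys)" for v
      by (simp add: t_def nth_append)
    then show ?thesis
      by (simp only: linear_mult_const' L)
  next
    case greater
    then obtain j where j: "i = Suc (length xs + j)"
      by (auto dest: less_imp_Suc_add)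
    then have "t v i = L (ys ! j) * \<beta> (xs @ v # take j ys @ drop (Suc j) ys)" for v
      by (simp add: t_def nth_append)
    moreover have "linear (\<lambda>v. \<beta> (xs @ v # take j ys @ drop (Suc j) ys))"
      using i j len by (intro covectors_linear[OF \<beta>]) simp
    ultimately show ?thesis
      by (simp only: linear_mult_const)
  qed
  then have "linear (\<lambda>v. \<Sum>i<Suc k. (-1) ^ i * t v i)"
    by (intro linear_compose_sum ballI linear_mult_const) simp
  moreover have "wedge_left L \<beta> (xs @ v # ys) = (\<Sum>i<Suc k. (-1) ^ i * t v i)" for v
    using len by (simp add: wedge_left_def t_def)
  ultimately show "linear (\<lambda>v. wedge_left L \<beta> (xs @ v # ys))"
    by simp
next
  fix xs ys zs :: "'a list" and a
  let ?vs = "xs @ a # ys @ a # zs"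
  let ?p = "length xs" and ?q = "Suc (length xs + length ys)"
  define t where "t = (\<lambda>i. (-1) ^ i * (L (?vs ! i) * \<beta> (take i ?vs @ drop (Suc i) ?vs)))"
  have "t i = 0" if "i < length ?vs" "i \<noteq> ?p" "i \<noteq> ?q" for i
  proof -
    consider "i < ?p" | "?p < i" "i < ?q" | "?q < i"
      using \<open>i \<noteq> ?p\<close> \<open>i \<noteq> ?q\<close> by linarith
    then have "\<beta> (take i ?vs @ drop (Suc i) ?vs) = 0"
    proof cases
      case 1
      then show ?thesis
        using covectors_alternating[OF \<beta>, of "take i xs @ drop (Suc i) xs" a ys zs] by simp
    next
      case 2
      then obtain j where j: "i = Suc (length xs + j)"
        by (auto dest: less_imp_Suc_add)
      with 2 show ?thesis
        using covectors_alternating[OF \<beta>, of xs a "take j ys @ drop (Suc j) ys" zs] by simp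
    next
      case 3
      then obtain j where j: "i = Suc (?q + j)"
        by (auto dest: less_imp_Suc_add)
      then have "take i ?vs = xs @ a # ys @ a # take j zs"
        by simp
      moreover have "drop (Suc i) ((xs @ a # ys @ [a]) @ zs) = drop (Suc j) zs"
        unfolding drop_append using j by simp
      ultimately show ?thesis
        using covectors_alternating[OF \<beta>, of xs a ys "take j zs @ drop (Suc j) zs"] by simp
    qed
    then show ?thesis
      by (simp add: t_def)
  qed
  then have "sum t {..<length ?vs} = sum t {?p, ?q}"
    by (intro sum.mono_neutral_right) auto
  also have "\<dots> = t ?p + t ?q"
    by simp
  also have "t ?p = (-1) ^ ?p * (L a * \<beta> (xs @ ys @ a # zs))"
    by (simp add: t_def)
  also have "t ?q = (-1) ^ ?q * (L a * \<beta> (xs @ a # ys @ zs))"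
    by (simp add: t_def nth_append)
  \<comment> \<open>The signs of the two deletions differ by \<open>(-1) ^ (length ys + 1)\<close>.
    Moving \<open>a\<close> across \<open>ys\<close> contributes \<open>(-1) ^ length ys\<close>,
    which leaves a single minus sign.\<close>
  also have "\<dots> = - ((-1) ^ ?p * (L a * \<beta> (xs @ ys @ a # zs)))"
  proof -
    have "(- 1 * (r * s)) * (l * (s * b)) = - (r * (l * b))" if "s * s = 1" for r s l b :: real
      using that by algebra
    moreover have "(-1) ^ length ys * (-1) ^ length ys = (1 :: real)"
      by (simp flip: power_mult_distrib)
    ultimately show ?thesis
      unfolding covectors_move[OF \<beta>, of xs a ys zs] power_Suc power_add by blast
  qed
  finally show "wedge_left L \<beta> ?vs = 0"
    by (simp add: wedge_left_def t_def)
qed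

section \<open>Test forms and primitives of constant forms\<close>

lemma test_formsI:
  assumes "\<And>x. \<phi> x \<in> covectors k" "\<And>vs m. C_k m (\<lambda>x. \<phi> x vs)"
    and "compact K" "\<And>x vs. x \<notin> K \<Longrightarrow> \<phi> x vs = 0"
  shows "\<phi> \<in> test_forms k" "form_support \<phi> \<subseteq> K"
proof -
  have "{x. \<exists>vs. \<phi> x vs \<noteq> 0} \<subseteq> K"
    using assms(4) by auto
  then show *: "form_support \<phi> \<subseteq> K"
    unfolding form_support_def using compact_imp_closed[OF \<open>compact K\<close>] by (rule closure_minimal)
  have "closed (form_support \<phi>)"
    by (simp add: form_support_def)
  then have "compact (form_support \<phi>)"
    using * \<open>compact K\<close> by (metis compact_Int_closed inf.absorb_iff2)
  then show "\<phi> \<in> test_forms k"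
    using assms by (simp add: test_forms_def)
qed

lemma C_k_covector:
  fixes \<alpha> :: "'v::euclidean_space list \<Rightarrow> real"
  assumes "\<alpha> \<in> covectors k"
  shows "C_k m (\<lambda>x. \<alpha> (x # ws))"
proof (cases "Suc (length ws) = k")
  case True
  then have "linear (\<lambda>x. \<alpha> ([] @ x # ws))"
    by (intro covectors_linear[OF assms]) simp
  then show ?thesis
    by (intro C_k_bounded_linear) (simp add: linear_conv_bounded_linear)
next
  case False
  then have "\<alpha> (x # ws) = 0" for x
    by (intro covectors_length[OF assms]) simp
  then show ?thesis
    by (simp add: C_k_const)
qed

text \<open>For a constant form \<open>\<alpha>\<close> of degree \<open>k + 1\<close>, contraction with the position vector is, up to
  the factor \<open>k + 1\<close>, a primitive.\<close>

lemma ext_deriv_radial: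
  fixes \<alpha> :: "'v::euclidean_space list \<Rightarrow> real"
  assumes \<alpha>: "\<alpha> \<in> covectors (Suc k)" and h: "\<And>x. (h has_derivative h' x) (at x)"
  shows "ext_deriv (\<lambda>x vs. h x * \<alpha> (x # vs)) x vs =
    wedge_left (h' x) (\<lambda>ws. \<alpha> (x # ws)) vs + real (Suc k) * h x * \<alpha> vs"
proof (cases "length vs = Suc k")
  case True
  let ?omit = "\<lambda>i. take i vs @ drop (Suc i) vs"
  have "frechet_derivative (\<lambda>y. h y * \<alpha> (y # ?omit i)) (at x) (vs ! i) =
      h' x (vs ! i) * \<alpha> (x # ?omit i) + (-1) ^ i * (h x * \<alpha> vs)" if i: "i < length vs" for i
  proof -
    have "linear (\<lambda>y. \<alpha> ([] @ y # ?omit i))"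
      using i True by (intro covectors_linear[OF \<alpha>]) simp
    then have lin: "((\<lambda>y. \<alpha> (y # ?omit i)) has_derivative (\<lambda>y. \<alpha> (y # ?omit i))) (at x)"
      by (intro bounded_linear_imp_has_derivative) (simp add: linear_conv_bounded_linear)
    have "frechet_derivative (\<lambda>y. h y * \<alpha> (y # ?omit i)) (at x) =
        (\<lambda>v. h x * \<alpha> (v # ?omit i) + h' x v * \<alpha> (x # ?omit i))"
      using frechet_derivative_at[OF has_derivative_mult[OF h lin]] by simp
    \<comment> \<open>Returning \<open>vs ! i\<close> to its place costs the sign that
      \<open>ext_deriv\<close> attaches to the term. Each of the \<open>k + 1\<close> terms thus
      contributes \<open>h x * \<alpha> vs\<close>, whence the factor \<open>Suc k\<close>.\<close>
    moreover have "\<alpha> (vs ! i # ?omit i) = (-1) ^ i * \<alpha> vs"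
      using covectors_move[OF \<alpha>, of "[]" "vs ! i" "take i vs" "drop (Suc i) vs"] i
      by (simp add: id_take_nth_drop[symmetric])
    ultimately show ?thesis
      by simp
  qed
  then have "ext_deriv (\<lambda>x vs. h x * \<alpha> (x # vs)) x vs = (\<Sum>i<length vs. (-1) ^ i *
      (h' x (vs ! i) * \<alpha> (x # ?omit i) + (-1) ^ i * (h x * \<alpha> vs)))"
    unfolding ext_deriv_def by (intro sum.cong) auto
  also have "\<dots> = (\<Sum>i<length vs. (-1) ^ i * (h' x (vs ! i) * \<alpha> (x # ?omit i)) + h x * \<alpha> vs)"
    by (intro sum.cong refl) (simp add: distrib_left mult.assoc[symmetric] flip: power_mult_distrib)
  finally show ?thesis
    using True by (simp add: wedge_left_def sum.distrib)
next
  case False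
  then have "\<alpha> (y # take i vs @ drop (Suc i) vs) = 0" if "i < length vs" for y i
    using that by (intro covectors_length[OF \<alpha>]) auto
  then have "ext_deriv (\<lambda>x vs. h x * \<alpha> (x # vs)) x vs = 0"
    "wedge_left (h' x) (\<lambda>ws. \<alpha> (x # ws)) vs = 0"
    by (auto simp: ext_deriv_def wedge_left_def)
  with False show ?thesis
    by (simp add: covectors_length[OF \<alpha>])
qed

text \<open>The cutoff makes the radial primitive a test form; the term where the derivative hits
  the cutoff lives between the two balls, away from \<open>K\<close>. That
  \<open>ext_deriv \<psi>\<close> is again a test form is recorded because currents have their
  integral representation only on test forms.\<close>

lemma exists_local_primitive:
  fixes \<alpha> :: "'v::euclidean_space list \<Rightarrow> real"
  assumes \<alpha>: "\<alpha> \<in> covectors (Suc k)" and K: "bounded K"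
  obtains \<psi> where "\<psi> \<in> test_forms k" "ext_deriv \<psi> \<in> test_forms (Suc k)"
    "\<And>x. x \<in> K \<Longrightarrow> ext_deriv \<psi> x = (\<lambda>vs. real (Suc k) * \<alpha> vs)"
proof -
  obtain r where r: "r > 0" "K \<subseteq> ball 0 r"
    using bounded_subset_ballD[OF K] by blast
  have "0 \<le> r" "r < r + 1"
    using r by simp_all
  then obtain h :: "'v \<Rightarrow> real" where h: "\<And>m. C_k m h" "\<And>x. x \<in> cball 0 r \<Longrightarrow> h x = 1"
    "\<And>x. x \<notin> cball 0 (r + 1) \<Longrightarrow> h x = 0"
    by (rule exists_smooth_cutoff[where 'v = 'v]) blast
  define h' where "h' = (\<lambda>x. frechet_derivative h (at x))"
  have h': "(h has_derivative h' x) (at x)" for x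
    unfolding h'_def using h(1) by (rule C_k_Suc_has_derivative)
  have const: "h' x = (\<lambda>_. 0)" if "open U" "x \<in> U" "\<And>y. y \<in> U \<Longrightarrow> h y = c" for x U c
  proof -
    have "(h has_derivative (\<lambda>_. 0)) (at x)"
      by (rule has_derivative_transform_within_open[OF has_derivative_const[of c] that(1,2)])
        (simp add: that(3))
    then show ?thesis
      by (rule has_derivative_unique[OF h'])
  qed
  \<comment> \<open>The open ball is essential: \<open>h\<close> has to be constant near the point,
    and \<open>K\<close> was placed inside an open ball for this.\<close>
  have inside: "h' x = (\<lambda>_. 0)" if "x \<in> ball 0 r" for x
    by (rule const[OF open_ball that]) (simp add: h(2))
  have outside: "h' x = (\<lambda>_. 0)" if "x \<notin> cball 0 (r + 1)" for x
    by (rule const[of "- cball 0 (r + 1)"]) (use that h(3) in auto)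
  define \<psi> where "\<psi> = (\<lambda>x vs. h x * \<alpha> (x # vs))"
  have d\<psi>: "ext_deriv \<psi> = (\<lambda>x vs. wedge_left (h' x) (\<lambda>ws. \<alpha> (x # ws)) vs + real (Suc k) * h x * \<alpha> vs)"
    unfolding \<psi>_def by (intro ext ext_deriv_radial \<alpha> h')
  show thesis
  proof
    show "\<psi> \<in> test_forms k"
      unfolding \<psi>_def by (rule test_formsI(1)[where K = "cball 0 (r + 1)"])
        (use \<alpha> h in \<open>auto intro!: covectors_scale covectors_contract C_k_mult C_k_covector\<close>)
    show "ext_deriv \<psi> \<in> test_forms (Suc k)"
      unfolding d\<psi>
    proof (rule test_formsI(1)[where K = "cball 0 (r + 1)"])
      show "(\<lambda>vs. wedge_left (h' x) (\<lambda>ws. \<alpha> (x # ws)) vs + real (Suc k) * h x * \<alpha> vs)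
          \<in> covectors (Suc k)" for x
        by (intro covectors_add covectors_scale wedge_left_in_covectors covectors_contract \<alpha>
            has_derivative_linear[OF h'])
      have "C_k m (\<lambda>x. h' x v)" for m v
        using h(1)[of "Suc m"] by (simp add: h'_def)
      then show "C_k m (\<lambda>x. wedge_left (h' x) (\<lambda>ws. \<alpha> (x # ws)) vs + real (Suc k) * h x * \<alpha> vs)" for m vs
        unfolding wedge_left_def
        by (intro C_k_add C_k_sum C_k_mult C_k_const C_k_covector[OF \<alpha>] h(1))
      show "wedge_left (h' x) (\<lambda>ws. \<alpha> (x # ws)) vs + real (Suc k) * h x * \<alpha> vs = 0"
        if "x \<notin> cball 0 (r + 1)" for x vs
        using that by (simp add: outside h(3) wedge_left_def)
    qed simp
    show "ext_deriv \<psi> x = (\<lambda>vs. real (Suc k) * \<alpha> vs)" if "x \<in> K" for x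
    proof -
      have "x \<in> ball 0 r"
        using that r by blast
      then show ?thesis
        using h(2)[of x] by (simp add: d\<psi> inside wedge_left_def)
    qed
  qed
qed

section \<open>Determinant forms\<close>

lemma bij_betw_pos: "bij_betw (pos :: 'n::{finite,linorder} \<Rightarrow> nat) UNIV {..<CARD('n)}"
proof -
  have "pos i < pos j" if "i < j" for i j :: 'n
    unfolding pos_def using that by (intro psubset_card_mono) auto
  then have inj: "inj (pos :: 'n \<Rightarrow> nat)"
    by (intro injI) (metis less_irrefl linorder_less_linear)
  have "pos i < CARD('n)" for i :: 'n
    unfolding pos_def by (intro psubset_card_mono) auto
  then have "range (pos :: 'n \<Rightarrow> nat) \<subseteq> {..<CARD('n)}"
    by auto
  then have "range (pos :: 'n \<Rightarrow> nat) = {..<CARD('n)}"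
    by (intro card_subset_eq) (simp_all add: card_image inj)
  with inj show ?thesis
    by (simp add: bij_betw_def)
qed

lemma pos_less: "pos (i :: 'n::{finite,linorder}) < CARD('n)"
  using bij_betw_pos[where 'n = 'n] by (auto simp: bij_betw_def)

lemma pos_eq_iff: "pos i = pos j \<longleftrightarrow> i = j"
  using bij_betw_pos by (auto simp: bij_betw_def inj_on_def)

lemma exists_pos: "k < CARD('n) \<Longrightarrow> \<exists>i :: 'n::{finite,linorder}. pos i = k"
  using bij_betw_pos[where 'n = 'n] by (metis bij_betw_def imageE lessThan_iff)

text \<open>The notation \<open>real^'n^'n\<close> would force the sort of \<open>'n\<close> to be \<open>finite\<close> alone.\<close>

type_synonym 'n square = "((real, 'n) vec, 'n) vec"

text \<open>The wedge product of the one-forms \<open>L j\<close> in the order of the index type. It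
  yields both \<open>Re dz\<close> and the numerators and denominator of Cramer's rule.\<close>

definition det_form :: "('n::{finite,linorder} \<Rightarrow> 'v \<Rightarrow> real) \<Rightarrow> 'v list \<Rightarrow> real" where
  "det_form L vs = (if length vs = CARD('n) then det (\<chi> i j. L j (vs ! pos i) :: 'n square) else 0)"

lemma det_form_in_covectors:
  fixes L :: "'n::{finite,linorder} \<Rightarrow> 'v::real_vector \<Rightarrow> real"
  assumes L: "\<And>j. linear (L j)"
  shows "det_form L \<in> covectors CARD('n)"
proof (rule covectorsI)
  fix xs ys :: "'v list"
  assume len: "Suc (length xs + length ys) = CARD('n)"
  obtain k :: 'n where k: "pos k = length xs"
    using exists_pos[where 'n = 'n, of "length xs"] len by auto
  define Lrow where "Lrow = (\<lambda>v. (\<chi> j. L j v) :: (real, 'n) vec)"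
  define c where "c = (\<lambda>i :: 'n. Lrow ((xs @ 0 # ys) ! pos i))"
  have eq: "det_form L (xs @ v # ys) = det (\<chi> i. if i = k then Lrow v else c i)" for v
  proof -
    have "(xs @ v # ys) ! pos i = (if i = k then v else (xs @ 0 # ys) ! pos i)" for i
      using k pos_eq_iff[of i k] by (auto simp: nth_append nth_Cons')
    then show ?thesis
      using len by (auto simp: det_form_def Lrow_def c_def vec_eq_iff intro!: arg_cong[of _ _ det])
  qed
  show "linear (\<lambda>v. det_form L (xs @ v # ys))"
  proof (rule linearI)
    fix u v :: 'v and r :: real
    have Lrow_linear: "Lrow (u + v) = Lrow u + Lrow v" "Lrow (r *\<^sub>R v) = r *s Lrow v"
      by (simp_all add: Lrow_def vec_eq_iff linear_add[OF L] linear_scale[OF L])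
    show "det_form L (xs @ (u + v) # ys) = det_form L (xs @ u # ys) + det_form L (xs @ v # ys)"
      "det_form L (xs @ (r *\<^sub>R v) # ys) = r *\<^sub>R det_form L (xs @ v # ys)"
      unfolding eq Lrow_linear using det_row_add[of k "\<lambda>_. Lrow u" "\<lambda>_. Lrow v" c]
        det_row_mul[of k r "\<lambda>_. Lrow v" c] by simp_all
  qed
next
  fix xs ys zs :: "'v list" and a
  assume len: "Suc (Suc (length xs + length ys + length zs)) = CARD('n)"
  obtain k l :: 'n where kl: "pos k = length xs" "pos l = Suc (length xs + length ys)"
    using exists_pos[where 'n = 'n, of "length xs"]
      exists_pos[where 'n = 'n, of "Suc (length xs + length ys)"] len by auto
  let ?M = "(\<chi> i j. L j ((xs @ a # ys @ a # zs) ! pos i)) :: 'n square"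
  have "row k ?M = row l ?M"
    by (simp add: row_def vec_eq_iff kl nth_append)
  moreover have "k \<noteq> l"
  proof
    assume "k = l"
    with kl show False
      by simp
  qed
  ultimately have "det ?M = 0"
    by (intro det_identical_rows)
  then show "det_form L (xs @ a # ys @ a # zs) = 0"
    by (simp add: det_form_def)
qed (simp add: det_form_def)

text \<open>The determinant is a polynomial in the entries with coefficients 1 and -1.\<close>

lemma ring_hom_det:
  fixes h :: "'a::comm_ring_1 \<Rightarrow> 'b::comm_ring_1" and A :: "'a^'n^'n"
  assumes add: "\<And>x y. h (x + y) = h x + h y" and mult: "\<And>x y. h (x * y) = h x * h y" and one: "h 1 = 1"
  shows "h (det A) = det (\<chi> i j. h (A $ i $ j))"
proof -
  have zero: "h 0 = 0"
    using add[of 0 0] by simp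
  then have neg: "h (- x) = - h x" for x
    using add[of x "- x"] by (simp add: eq_neg_iff_add_eq_0 add.commute)
  have sum: "h (sum f S) = (\<Sum>i\<in>S. h (f i))" for f :: "('n \<Rightarrow> 'n) \<Rightarrow> 'a" and S
    by (induction S rule: infinite_finite_induct) (simp_all add: zero add)
  have prod: "h (prod f S) = (\<Prod>i\<in>S. h (f i))" for f :: "'n \<Rightarrow> 'a" and S
    by (induction S rule: infinite_finite_induct) (simp_all add: one mult)
  have sign: "h (of_int (sign p)) = of_int (sign p)" for p :: "'n \<Rightarrow> 'n"
    by (simp add: sign_def one neg)
  show ?thesis
    unfolding det_def by (simp add: sum mult sign prod)
qed

section \<open>Real and imaginary parts of a frame\<close>

definition real_rows :: "'n::{finite,linorder} Dn list \<Rightarrow> 'n square" where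
  "real_rows vs = (\<chi> i j. DRe ((vs ! pos i) $ j))"

definition imag_rows :: "'n::{finite,linorder} Dn list \<Rightarrow> 'n square" where
  "imag_rows vs = (\<chi> i j. DIm ((vs ! pos i) $ j))"

text \<open>The ring homomorphisms \<open>x + \<tau>y \<mapsto> x \<plusminus> y\<close> split the double numbers into \<open>\<real> \<times> \<real>\<close>.\<close>

lemma DRe_dz: "DRe (dz vs) = (det (real_rows vs + imag_rows vs) + det (real_rows vs - imag_rows vs)) / 2"
  and DIm_dz: "DIm (dz vs) = (det (real_rows vs + imag_rows vs) - det (real_rows vs - imag_rows vs)) / 2"
proof -
  let ?A = "\<chi> i j. (vs ! pos i) $ j"
  have "DRe (det ?A) + DIm (det ?A) = det (real_rows vs + imag_rows vs)"
    by (subst ring_hom_det[of "\<lambda>z. DRe z + DIm z"])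
      (auto simp: algebra_simps real_rows_def imag_rows_def plus_vec_def)
  moreover have "DRe (det ?A) - DIm (det ?A) = det (real_rows vs - imag_rows vs)"
    by (subst ring_hom_det[of "\<lambda>z. DRe z - DIm z"])
      (auto simp: algebra_simps real_rows_def imag_rows_def minus_vec_def)
  ultimately show "DRe (dz vs) = (det (real_rows vs + imag_rows vs) + det (real_rows vs - imag_rows vs)) / 2"
    "DIm (dz vs) = (det (real_rows vs + imag_rows vs) - det (real_rows vs - imag_rows vs)) / 2"
    by (simp_all add: dz_def)
qed

text \<open>\<open>dz\<close> looks up list positions without checking the length; the guard turns
  its real part into a covector.\<close>

definition re_dz :: "'n::{finite,linorder} Dn list \<Rightarrow> real" where
  "re_dz vs = (if length vs = CARD('n) then DRe (dz vs) else 0)"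

lemma re_dz_in_covectors: "(re_dz :: 'n::{finite,linorder} Dn list \<Rightarrow> real) \<in> covectors CARD('n)"
proof -
  have "re_dz vs = 1 / 2 * (det_form (\<lambda>j v. DRe (v $ j) + DIm (v $ j)) vs +
      det_form (\<lambda>j v. DRe (v $ j) - DIm (v $ j)) vs)" for vs :: "'n Dn list"
    by (simp add: re_dz_def det_form_def DRe_dz real_rows_def imag_rows_def plus_vec_def minus_vec_def)
  then have eq: "re_dz = (\<lambda>vs :: 'n Dn list. 1 / 2 * (det_form (\<lambda>j v. DRe (v $ j) + DIm (v $ j)) vs +
      det_form (\<lambda>j v. DRe (v $ j) - DIm (v $ j)) vs))"
    by (rule ext)
  have "linear (\<lambda>v :: 'n Dn. DRe (v $ j) + DIm (v $ j))"
    "linear (\<lambda>v :: 'n Dn. DRe (v $ j) - DIm (v $ j))" for j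
    by (auto intro!: linearI simp: algebra_simps)
  then show ?thesis
    unfolding eq by (intro covectors_scale covectors_add det_form_in_covectors)
qed


section \<open>The calibration inequality\<close>

lemma pos_orthonormal_basis_matrix:
  fixes vs :: "'n::{finite,linorder} Dn list"
  assumes "pos_orthonormal_basis P vs"
  shows "real_rows vs ** transpose (real_rows vs) - imag_rows vs ** transpose (imag_rows vs) = mat 1"
    and "det (real_rows vs) > 0"
proof -
  have "split_inner (vs ! pos i) (vs ! pos j) = (if i = j then 1 else 0)" for i j :: 'n
    using assms pos_less[of i] pos_less[of j] pos_eq_iff[of i j] by (simp add: pos_orthonormal_basis_def)
  then show "real_rows vs ** transpose (real_rows vs) - imag_rows vs ** transpose (imag_rows vs) = mat 1"
    by (simp add: vec_eq_iff matrix_matrix_mult_def transpose_def mat_def real_rows_def imag_rows_def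
        split_inner_def sum_subtractf)
  show "det (real_rows vs) > 0"
    using assms by (simp add: pos_orthonormal_basis_def real_rows_def)
qed

lemma omega_commute: "omega u v = - omega v u"
  unfolding omega_def by (simp add: sum_subtractf mult.commute)

text \<open>The order of the arguments makes this
  \<open>Y ** transpose X - X ** transpose Y\<close>, the skew matrix of
  \<open>spacelike_det_product\<close>.\<close>

definition omega_matrix :: "'n::{finite,linorder} Dn list \<Rightarrow> 'n square" where
  "omega_matrix vs = (\<chi> i j. omega (vs ! pos j) (vs ! pos i))"

lemma transpose_omega_matrix: "transpose (omega_matrix vs) = - omega_matrix vs"
  by (simp add: transpose_def omega_matrix_def vec_eq_iff omega_commute[symmetric])

text \<open>The parameters 1 and -1 of \<open>det_spacelike_pos\<close> give positivity. The
  absolute value matches the bounds for skew matrices and is correct because the product is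
  positive.\<close>

lemma pos_orthonormal_basis_dets:
  assumes "pos_orthonormal_basis P vs"
  shows "det (real_rows vs + imag_rows vs) > 0" "det (real_rows vs - imag_rows vs) > 0"
    "det (real_rows vs + imag_rows vs) * det (real_rows vs - imag_rows vs) = \<bar>det (mat 1 + omega_matrix vs)\<bar>"
proof -
  note XY = pos_orthonormal_basis_matrix[OF assms]
  show pos: "det (real_rows vs + imag_rows vs) > 0" "det (real_rows vs - imag_rows vs) > 0"
    using det_spacelike_pos[OF XY, of 1] det_spacelike_pos[OF XY, of "-1"] by simp_all
  have "imag_rows vs ** transpose (real_rows vs) - real_rows vs ** transpose (imag_rows vs) = omega_matrix vs"
    by (simp add: vec_eq_iff matrix_matrix_mult_def transpose_def real_rows_def imag_rows_def
        omega_matrix_def omega_def sum_subtractf algebra_simps)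
  then have "det (real_rows vs + imag_rows vs) * det (real_rows vs - imag_rows vs) = det (mat 1 + omega_matrix vs)"
    using spacelike_det_product[OF XY(1)] by simp
  then show "det (real_rows vs + imag_rows vs) * det (real_rows vs - imag_rows vs) = \<bar>det (mat 1 + omega_matrix vs)\<bar>"
    using mult_pos_pos[OF pos] by simp
qed

text \<open>For half the sum and half the difference of \<open>a\<close> and \<open>b\<close>, the
  squares differ by \<open>a * b\<close>.\<close>

lemma DRe_dz_squared:
  assumes "pos_orthonormal_basis P vs"
  shows "(DRe (dz vs))\<^sup>2 = (DIm (dz vs))\<^sup>2 + \<bar>det (mat 1 + omega_matrix vs)\<bar>"
  unfolding pos_orthonormal_basis_dets(3)[OF assms, symmetric]
  by (simp add: DRe_dz DIm_dz power2_eq_square field_simps)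

lemma DRe_dz_ge_1:
  assumes "pos_orthonormal_basis P vs"
  shows "1 \<le> DRe (dz vs)"
proof -
  have "1 \<le> (DRe (dz vs))\<^sup>2"
    using DRe_dz_squared[OF assms] abs_det_one_plus_skew_ge_1[OF transpose_omega_matrix, of vs]
      zero_le_power2[of "DIm (dz vs)"] by linarith
  moreover have "0 \<le> DRe (dz vs)"
    using pos_orthonormal_basis_dets(1,2)[OF assms] by (simp add: DRe_dz)
  ultimately show ?thesis
    using power2_le_imp_le[of 1 "DRe (dz vs)"] by simp
qed

lemma linear_omega_right: "linear (omega u)"
  unfolding omega_def
  by (intro linearI) (simp_all add: sum.distrib sum_subtractf sum_distrib_left algebra_simps)

lemma linear_omega_left: "linear (\<lambda>u. omega u v)"
proof -
  have "(\<lambda>u. omega u v) = (\<lambda>u. - omega v u)"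
    by (rule ext) (rule omega_commute)
  then show ?thesis
    using linear_compose_neg[OF linear_omega_right] by metis
qed

lemma omega_matrix_eq_0_iff:
  fixes vs :: "'n::{finite,linorder} Dn list"
  assumes "pos_orthonormal_basis P vs"
  shows "omega_matrix vs = 0 \<longleftrightarrow> (\<forall>u\<in>P. \<forall>v\<in>P. omega u v = 0)"
proof
  have P: "P = span (set vs)" and len: "length vs = CARD('n)"
    using assms by (auto simp: pos_orthonormal_basis_def)
  show "omega_matrix vs = 0" if "\<forall>u\<in>P. \<forall>v\<in>P. omega u v = 0"
  proof -
    have "vs ! pos i \<in> P" for i :: 'n
      unfolding P by (intro span_base nth_mem) (simp add: len pos_less)
    with that show ?thesis
      by (simp add: omega_matrix_def vec_eq_iff)
  qed
  show "\<forall>u\<in>P. \<forall>v\<in>P. omega u v = 0" if 0: "omega_matrix vs = 0"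
  proof -
    have *: "omega u v = 0" if uv: "u \<in> set vs" "v \<in> set vs" for u v
    proof -
      have "\<exists>i :: 'n. w = vs ! pos i" if "w \<in> set vs" for w
        using that exists_pos[where 'n = 'n] len unfolding in_set_conv_nth by fastforce
      then obtain i j :: 'n where "u = vs ! pos i" "v = vs ! pos j"
        using uv by blast
      then have "omega u v = omega_matrix vs $ j $ i"
        by (simp add: omega_matrix_def)
      then show ?thesis
        by (simp add: 0)
    qed
    have **: "omega u v = 0" if u: "u \<in> set vs" and v: "v \<in> span (set vs)" for u v
      by (rule linear_eq_0_on_span[OF linear_omega_right _ v]) (rule *[OF u])
    have "omega u v = 0" if u: "u \<in> span (set vs)" and v: "v \<in> span (set vs)" for u v
      by (rule linear_eq_0_on_span[OF linear_omega_left _ u]) (rule **[OF _ v])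
    then show ?thesis
      by (simp add: P)
  qed
qed

text \<open>If the square of \<open>Im dz\<close> and a determinant of size at least 1 add up to 1,
  both are minimal, and a determinant of size 1 forces the skew matrix to vanish.\<close>

lemma DRe_dz_eq_1_iff:
  assumes "pos_orthonormal_basis P vs"
  shows "DRe (dz vs) = 1 \<longleftrightarrow> (\<forall>u\<in>P. \<forall>v\<in>P. omega u v = 0) \<and> DIm (dz vs) = 0"
  unfolding omega_matrix_eq_0_iff[OF assms, symmetric]
proof
  assume 1: "DRe (dz vs) = 1"
  have "(DIm (dz vs))\<^sup>2 + \<bar>det (mat 1 + omega_matrix vs)\<bar> = 1"
    using DRe_dz_squared[OF assms] 1 by simp
  moreover have "\<bar>det (mat 1 + omega_matrix vs)\<bar> \<ge> 1"
    by (rule abs_det_one_plus_skew_ge_1[OF transpose_omega_matrix])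
  ultimately have "(DIm (dz vs))\<^sup>2 = 0" "\<bar>det (mat 1 + omega_matrix vs)\<bar> = 1"
    using zero_le_power2[of "DIm (dz vs)"] by linarith+
  then show "omega_matrix vs = 0 \<and> DIm (dz vs) = 0"
    using abs_det_one_plus_skew_eq_1[OF transpose_omega_matrix] by simp
next
  assume "omega_matrix vs = 0 \<and> DIm (dz vs) = 0"
  then have "(DRe (dz vs))\<^sup>2 = 1"
    using DRe_dz_squared[OF assms] by simp
  then show "DRe (dz vs) = 1"
    using DRe_dz_ge_1[OF assms] by (auto simp: power2_eq_1_iff)
qed

lemma G_space_plusE:
  fixes \<eta> :: "'n::{finite,linorder} Dn multivector"
  assumes "\<eta> \<in> G_space_plus"
  obtains P vs where "spacelike_plane P" "pos_orthonormal_basis P vs" "length vs = CARD('n)"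
    "\<And>\<alpha>. \<alpha> \<in> covectors CARD('n) \<Longrightarrow> \<eta> \<alpha> = \<alpha> vs" "\<eta> = wedge vs"
proof -
  obtain P vs where "spacelike_plane P" "pos_orthonormal_basis P vs" "\<eta> = wedge vs"
    using assms unfolding G_space_plus_def by blast
  moreover from this have "length vs = CARD('n)"
    by (simp add: pos_orthonormal_basis_def)
  ultimately show thesis
    using that[of P vs] by (simp add: wedge_def)
qed

lemma G_space_plus_re_dz_ge_1: "\<eta> \<in> G_space_plus \<Longrightarrow> 1 \<le> \<eta> re_dz"
  by (elim G_space_plusE) (simp add: re_dz_in_covectors re_dz_def DRe_dz_ge_1)

lemma G_space_plus_re_dz_eq_1_iff:
  fixes \<eta> :: "'n::{finite,linorder} Dn multivector"
  assumes "\<eta> \<in> G_space_plus"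
  shows "\<eta> re_dz = 1 \<longleftrightarrow> \<eta> \<in> SLAG"
proof
  obtain P vs where vs: "spacelike_plane P" "pos_orthonormal_basis P vs" "length vs = CARD('n)"
    "\<And>\<alpha>. \<alpha> \<in> covectors CARD('n) \<Longrightarrow> \<eta> \<alpha> = \<alpha> vs" "\<eta> = wedge vs"
    using assms by (rule G_space_plusE) blast
  show "\<eta> \<in> SLAG" if "\<eta> re_dz = 1"
  proof -
    have "DRe (dz vs) = 1"
      using that vs(3,4) re_dz_in_covectors[where 'n = 'n] by (simp add: re_dz_def)
    then show ?thesis
      unfolding SLAG_def using DRe_dz_eq_1_iff[OF vs(2)] vs by blast
  qed
next
  assume "\<eta> \<in> SLAG"
  then obtain P vs where vs: "\<eta> = wedge vs" "pos_orthonormal_basis P vs"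
    "(\<forall>u\<in>P. \<forall>v\<in>P. omega u v = 0) \<and> DIm (dz vs) = 0"
    unfolding SLAG_def by blast
  then have "DRe (dz vs) = 1"
    using DRe_dz_eq_1_iff by blast
  with vs show "\<eta> re_dz = 1"
    by (simp add: wedge_def pos_orthonormal_basis_def re_dz_in_covectors re_dz_def)
qed

section \<open>Existence of the polar decomposition\<close>

text \<open>Ratios of Pluecker coordinates, hence unchanged when \<open>\<xi>\<close> is
  rescaled.\<close>

definition graph_matrix :: "'n::{finite,linorder} Dn multivector \<Rightarrow> 'n square" where
  "graph_matrix \<xi> = (\<chi> k j. \<xi> (det_form (\<lambda>l v. if l = k then DIm (v $ j) else DRe (v $ l))) /
     \<xi> (det_form (\<lambda>l v. DRe (v $ l))))"

text \<open>A space-like plane is the graph of a linear map from \<open>\<real>\<^sup>n\<close> to \<open>\<tau>\<real>\<^sup>n\<close>, whose matrix is read off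
  the coordinates of the \<open>n\<close>-vector by Cramer's rule. The resulting length is a measurable function
  of these coordinates.\<close>

definition split_length :: "'n::{finite,linorder} Dn multivector \<Rightarrow> real" where
  "split_length \<xi> = \<xi> (det_form (\<lambda>l v. DRe (v $ l))) *
     sqrt (det (mat 1 - graph_matrix \<xi> ** transpose (graph_matrix \<xi>)))"

lemma det_form_coordinates_in_covectors:
  "det_form (\<lambda>l (v :: 'n::{finite,linorder} Dn). DRe (v $ l)) \<in> covectors CARD('n)"
  "det_form (\<lambda>l (v :: 'n::{finite,linorder} Dn). if l = k then DIm (v $ j) else DRe (v $ l))
     \<in> covectors CARD('n)"
proof -
  have "linear (\<lambda>v :: 'n Dn. DRe (v $ l))" "linear (\<lambda>v :: 'n Dn. DIm (v $ l))" for l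
    by (auto intro!: linearI)
  then have "linear (\<lambda>v :: 'n Dn. DRe (v $ l))"
    "linear (\<lambda>v :: 'n Dn. if l = k then DIm (v $ j) else DRe (v $ l))" for l
    by (cases "l = k"; simp)+
  then show "det_form (\<lambda>l (v :: 'n Dn). DRe (v $ l)) \<in> covectors CARD('n)"
    "det_form (\<lambda>l (v :: 'n Dn). if l = k then DIm (v $ j) else DRe (v $ l)) \<in> covectors CARD('n)"
    by (intro det_form_in_covectors; simp)+
qed

text \<open>The graph matrix \<open>A\<close> solves \<open>X ** A = Y\<close>, so
  \<open>X ** (1 - A ** transpose A) ** transpose X\<close> is the identity and the square root is
  \<open>1 / det X\<close>. It cancels the factor \<open>det X\<close> in the leading coordinate
  \<open>c * det X\<close>.\<close>

lemma split_length_eq: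
  fixes \<eta> :: "'n::{finite,linorder} Dn multivector"
  assumes \<eta>: "\<eta> \<in> G_space_plus" and c: "c > 0"
    and \<xi>: "\<And>\<alpha>. \<alpha> \<in> covectors CARD('n) \<Longrightarrow> \<xi> \<alpha> = c * \<eta> \<alpha>"
  shows "split_length \<xi> = c"
proof -
  obtain P vs where vs: "spacelike_plane P" "pos_orthonormal_basis P vs" "length vs = CARD('n)"
    "\<And>\<alpha>. \<alpha> \<in> covectors CARD('n) \<Longrightarrow> \<eta> \<alpha> = \<alpha> vs" "\<eta> = wedge vs"
    using \<eta> by (rule G_space_plusE) blast
  define X where "X = real_rows vs"
  define Y where "Y = imag_rows vs"
  define A where "A = graph_matrix \<xi>"
  have XY: "X ** transpose X - Y ** transpose Y = mat 1" and X: "det X > 0"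
    unfolding X_def Y_def using pos_orthonormal_basis_matrix[OF vs(2)] by auto
  have \<xi>0: "\<xi> (det_form (\<lambda>l v. DRe (v $ l))) = c * det X"
    by (simp add: \<xi> vs(3,4) det_form_coordinates_in_covectors det_form_def X_def real_rows_def)
  have \<xi>1: "\<xi> (det_form (\<lambda>l v. if l = k then DIm (v $ j) else DRe (v $ l))) =
      c * det ((\<chi> i l. if l = k then Y $ i $ j else X $ i $ l) :: 'n square)" for k j
    by (simp add: \<xi> vs(3,4) det_form_coordinates_in_covectors det_form_def X_def Y_def
        real_rows_def imag_rows_def cong: if_cong)
  have "X *v column j A = column j Y" for j
    using X c by (subst cramer) (auto simp: column_def A_def graph_matrix_def \<xi>0 \<xi>1 vec_eq_iff cong: if_cong)
  then have XA: "X ** A = Y"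
    by (simp add: vec_eq_iff matrix_matrix_mult_def matrix_vector_mult_def column_def)
  have mult_diff: "B ** (C - D) = B ** C - B ** D" "(C - D) ** B = C ** B - D ** B" for B C D :: "'n square"
    by (simp_all add: vec_eq_iff matrix_matrix_mult_def sum_subtractf algebra_simps)
  have "X ** (mat 1 - A ** transpose A) ** transpose X = X ** transpose X - Y ** transpose Y"
    unfolding XA[symmetric]
    by (simp add: matrix_transpose_mul matrix_mul_assoc mult_diff)
  then have "det X * det (mat 1 - A ** transpose A) * det X = 1"
    unfolding XY by (metis det_I det_mul det_transpose)
  then have "det (mat 1 - A ** transpose A) = (1 / det X)\<^sup>2"
    using X by (simp add: field_simps power2_eq_square)
  then have "sqrt (det (mat 1 - A ** transpose A)) = 1 / det X"
    using X by (simp only: real_sqrt_abs) simp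
  then show ?thesis
    using X by (simp add: split_length_def \<xi>0 A_def[symmetric])
qed

lemma split_length_measurable:
  fixes \<xi> :: "'a \<Rightarrow> 'n::{finite,linorder} Dn multivector"
  assumes \<xi>: "\<And>\<alpha>. \<alpha> \<in> covectors CARD('n) \<Longrightarrow> (\<lambda>x. \<xi> x \<alpha>) \<in> borel_measurable M"
  shows "(\<lambda>x. split_length (\<xi> x)) \<in> borel_measurable M"
proof -
  note [measurable] = \<xi>[OF det_form_coordinates_in_covectors(1)] \<xi>[OF det_form_coordinates_in_covectors(2)]
  have [measurable]: "(\<lambda>x. graph_matrix (\<xi> x) $ i $ j) \<in> borel_measurable M" for i j
    by (simp add: graph_matrix_def)
  have [measurable]: "(\<lambda>x. (mat 1 - graph_matrix (\<xi> x) ** transpose (graph_matrix (\<xi> x))) $ i $ j)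
      \<in> borel_measurable M" for i j
    by (simp add: matrix_matrix_mult_def transpose_def mat_def)
  show ?thesis
    unfolding split_length_def det_def by measurable
qed

text \<open>A Euclidean unit vector has coordinates of size at most 1, so the entries of
  \<open>X + Y\<close> and \<open>X - Y\<close> are at most 2.\<close>

lemma abs_re_dz_orthonormal_le:
  fixes vs :: "'n::{finite,linorder} Dn list"
  assumes len: "length vs = CARD('n)"
    and on: "\<And>i j. i < CARD('n) \<Longrightarrow> j < CARD('n) \<Longrightarrow> inner (vs ! i) (vs ! j) = (if i = j then 1 else 0)"
  shows "\<bar>re_dz vs\<bar> \<le> fact CARD('n) * 2 ^ CARD('n)"
proof -
  have entry: "\<bar>DRe ((vs ! pos i) $ j)\<bar> \<le> 1" "\<bar>DIm ((vs ! pos i) $ j)\<bar> \<le> 1" for i j :: 'n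
  proof -
    have "norm (vs ! pos i) = 1"
      using on[of "pos i" "pos i"] pos_less[of i] by (simp add: norm_eq_sqrt_inner)
    then have "norm ((vs ! pos i) $ j) \<le> 1"
      using Finite_Cartesian_Product.norm_nth_le[of "vs ! pos i" j] by simp
    moreover have "\<bar>DRe z\<bar> \<le> norm z" "\<bar>DIm z\<bar> \<le> norm z" for z :: double
      by (auto simp: norm_double_def inner_double_def intro!: real_le_rsqrt simp: power2_eq_square)
    ultimately show "\<bar>DRe ((vs ! pos i) $ j)\<bar> \<le> 1" "\<bar>DIm ((vs ! pos i) $ j)\<bar> \<le> 1"
      by (meson order_trans)+
  qed
  have "\<bar>(real_rows vs + imag_rows vs) $ i $ j\<bar> \<le> 2" "\<bar>(real_rows vs - imag_rows vs) $ i $ j\<bar> \<le> 2" for i j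
    using entry[of i j] by (auto simp: real_rows_def imag_rows_def abs_le_iff)
  from abs_det_le[OF this(1)] abs_det_le[OF this(2)] show ?thesis
    using len by (simp add: re_dz_def DRe_dz abs_le_iff)
qed

section \<open>Assembling the mass measure and the orienting field\<close>

lemma sets_hausdorff_measure: "sets (hausdorff_measure k) = sets borel"
  using sets.sigma_sets_eq[of borel] by (simp add: hausdorff_measure_def)

lemma exists_polar_decomposition:
  fixes T :: "'n::{finite,linorder} current"
  assumes "positive_spacelike T"
  shows "\<exists>\<mu> \<tau>. polar_decomposition T \<mu> \<tau>"
proof -
  define H where "H = (hausdorff_measure CARD('n) :: 'n Dn measure)"
  obtain M \<theta> \<xi> where data: "rectifiable_data T M \<theta> \<xi>"
    and spacelike: "AE x in H. x \<in> M \<longrightarrow> (\<exists>c>0. \<exists>\<eta>\<in>G_space_plus. \<xi> x = (\<lambda>\<alpha>. c * \<eta> \<alpha>))"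
    using assms unfolding positive_spacelike_def H_def by blast
  have sets_H [measurable_cong, simp]: "sets H = sets borel"
    unfolding H_def by (rule sets_hausdorff_measure)
  have M [measurable]: "M \<in> sets borel"
    and \<theta> [measurable]: "\<theta> \<in> borel \<rightarrow>\<^sub>M count_space UNIV"
    and \<theta>_pos: "\<And>x. x \<in> M \<Longrightarrow> \<theta> x > 0"
    and finite: "\<And>K. compact K \<Longrightarrow> (\<integral>\<^sup>+x\<in>M \<inter> K. of_nat (\<theta> x) \<partial>H) < \<infinity>"
    and \<xi>_meas: "\<And>\<alpha>. \<alpha> \<in> covectors CARD('n) \<Longrightarrow> (\<lambda>x. \<xi> x \<alpha>) \<in> borel_measurable borel"
    and tangent: "AE x in H. x \<in> M \<longrightarrow> (\<exists>vs. length vs = CARD('n) \<and>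
      (\<forall>i<CARD('n). \<forall>j<CARD('n). inner (vs ! i) (vs ! j) = (if i = j then 1 else 0)) \<and>
      approx_tangent_plane CARD('n) M x (span (set vs)) \<and> \<xi> x = wedge vs)"
    and T: "\<And>\<phi>. \<phi> \<in> test_forms CARD('n) \<Longrightarrow>
      has_bochner_integral H (\<lambda>x. indicator M x * (real (\<theta> x) * \<xi> x (\<phi> x))) (T \<phi>)"
    using data unfolding rectifiable_data_def Let_def H_def[symmetric] by auto
  define C :: real where "C = fact CARD('n) * 2 ^ CARD('n)"
  have good: "AE x in H. x \<in> M \<longrightarrow> 0 < split_length (\<xi> x) \<and> split_length (\<xi> x) \<le> C \<and>
      (\<exists>\<eta>\<in>G_space_plus. \<xi> x = (\<lambda>\<alpha>. split_length (\<xi> x) * \<eta> \<alpha>))"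
    using spacelike tangent
  proof eventually_elim
    case (elim x)
    show ?case
    proof
      assume "x \<in> M"
      then obtain c \<eta> vs where c: "c > 0" "\<eta> \<in> G_space_plus" "\<xi> x = (\<lambda>\<alpha>. c * \<eta> \<alpha>)"
        and vs: "length vs = CARD('n)" "\<xi> x = wedge vs" "\<And>i j. i < CARD('n) \<Longrightarrow> j < CARD('n) \<Longrightarrow>
          inner (vs ! i) (vs ! j) = (if i = j then 1 else 0)"
        using elim by blast
      have len: "split_length (\<xi> x) = c"
        by (rule split_length_eq[OF c(2,1)]) (simp add: c(3))
      \<comment> \<open>The calibration inequality bounds the space-like length by
        \<open>Re dz\<close>, and the Euclidean frame bounds \<open>Re dz\<close> by
        \<open>C\<close>. This uniform bound makes the new measure finite on compact sets.\<close>
      have "c \<le> c * \<eta> re_dz"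
        using c(1) G_space_plus_re_dz_ge_1[OF c(2)] by simp
      also have "\<dots> = \<xi> x re_dz"
        by (simp add: c(3))
      also have "\<dots> = re_dz vs"
        by (simp add: vs(1,2) wedge_def re_dz_in_covectors)
      also have "\<dots> \<le> C"
        unfolding C_def using abs_re_dz_orthonormal_le[OF vs(1,3)] by simp
      finally show "0 < split_length (\<xi> x) \<and> split_length (\<xi> x) \<le> C \<and>
          (\<exists>\<eta>\<in>G_space_plus. \<xi> x = (\<lambda>\<alpha>. split_length (\<xi> x) * \<eta> \<alpha>))"
        using c len by auto
    qed
  qed
  have [measurable]: "(\<lambda>x. split_length (\<xi> x)) \<in> borel_measurable borel"
    by (rule split_length_measurable) (rule \<xi>_meas)
  have [measurable]: "(\<lambda>x. real (\<theta> x)) \<in> borel_measurable borel"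
    by measurable
  define w where "w = (\<lambda>x. indicator M x * (real (\<theta> x) * split_length (\<xi> x)))"
  have w_meas [measurable]: "w \<in> borel_measurable borel"
    unfolding w_def by measurable
  define \<mu> where "\<mu> = density H (\<lambda>x. ennreal (w x))"
  \<comment> \<open>On \<open>M\<close> this is almost everywhere \<open>\<xi> x\<close> divided by
    its length; off \<open>M\<close> it is \<open>0 / 0 = 0\<close>. The indicator and
    \<open>\<theta>\<close> stay in the numerator because for a varying form \<open>\<phi>\<close>
    measurability is known only for the whole integrand of \<open>T\<close>.\<close>
  define \<tau> where "\<tau> = (\<lambda>x \<alpha>. (indicator M x * (real (\<theta> x) * \<xi> x \<alpha>)) / w x)"
  have \<tau>_G: "AE x in H. x \<in> M \<longrightarrow> \<tau> x \<in> G_space_plus"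
    using good
  proof eventually_elim
    case (elim x)
    show ?case
    proof
      assume x: "x \<in> M"
      then obtain \<eta> where \<eta>: "\<eta> \<in> G_space_plus" "\<xi> x = (\<lambda>\<alpha>. split_length (\<xi> x) * \<eta> \<alpha>)"
        and pos: "0 < split_length (\<xi> x)"
        using elim by blast
      have "\<tau> x \<alpha> = \<eta> \<alpha>" for \<alpha>
        using x pos \<theta>_pos[OF x] fun_cong[OF \<eta>(2), of \<alpha>] by (simp add: \<tau>_def w_def field_simps)
      then have "\<tau> x = \<eta>" ..
      with \<eta>(1) show "\<tau> x \<in> G_space_plus"
        by simp
    qed
  qed
  have w_nonneg: "AE x in H. 0 \<le> w x"
    using good by eventually_elim (auto simp: w_def indicator_def)
  have "polar_decomposition T \<mu> \<tau>"
    unfolding polar_decomposition_def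
  proof (intro conjI allI ballI impI)
    show "sets \<mu> = sets borel"
      by (simp add: \<mu>_def)
    show "emeasure \<mu> K < \<infinity>" if K: "compact K" for K
    proof -
      have [measurable]: "K \<in> sets borel"
        using K by (simp add: compact_imp_closed borel_closed)
      have "emeasure \<mu> K = (\<integral>\<^sup>+x. ennreal (w x) * indicator K x \<partial>H)"
        unfolding \<mu>_def by (subst emeasure_density) simp_all
      also have "\<dots> \<le> (\<integral>\<^sup>+x. ennreal C * (of_nat (\<theta> x) * indicator (M \<inter> K) x) \<partial>H)"
      proof (rule nn_integral_mono_AE)
        show "AE x in H. ennreal (w x) * indicator K x \<le> ennreal C * (of_nat (\<theta> x) * indicator (M \<inter> K) x)"
          using good
        proof eventually_elim
          case (elim x)
          then have "x \<in> M \<Longrightarrow> ennreal (real (\<theta> x) * split_length (\<xi> x)) \<le> ennreal (real (\<theta> x) * C)"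
            by (intro ennreal_leI mult_left_mono) simp_all
          then show ?case
            by (auto simp: w_def indicator_def C_def ennreal_mult ennreal_of_nat_eq_real_of_nat mult.commute)
        qed
      qed
      also have "\<dots> = ennreal C * (\<integral>\<^sup>+x\<in>M \<inter> K. of_nat (\<theta> x) \<partial>H)"
        by (rule nn_integral_cmult) measurable
      also have "\<dots> < \<infinity>"
        using finite[OF K] by (simp add: ennreal_mult_less_top)
      finally show ?thesis .
    qed
    show "(\<lambda>x. \<tau> x \<alpha>) \<in> borel_measurable borel" if "\<alpha> \<in> covectors CARD('n)" for \<alpha>
    proof -
      note [measurable] = \<xi>_meas[OF that]
      show ?thesis
        unfolding \<tau>_def by measurable
    qed
    show "AE x in \<mu>. \<tau> x \<in> G_space_plus"
    proof -
      have "AE x in H. 0 < ennreal (w x) \<longrightarrow> \<tau> x \<in> G_space_plus"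
        using \<tau>_G by eventually_elim (auto simp: w_def indicator_def)
      then show ?thesis
        unfolding \<mu>_def by (subst AE_density) simp_all
    qed
    show "has_bochner_integral \<mu> (\<lambda>x. \<tau> x (\<phi> x)) (T \<phi>)" if \<phi>: "\<phi> \<in> test_forms CARD('n)" for \<phi>
    proof -
      note T\<phi> = T[OF \<phi>]
      have [measurable]: "(\<lambda>x. indicator M x * (real (\<theta> x) * \<xi> x (\<phi> x))) \<in> borel_measurable borel"
        using borel_measurable_has_bochner_integral[OF T\<phi>] by simp
      have \<tau>\<phi> [measurable]: "(\<lambda>x. \<tau> x (\<phi> x)) \<in> borel_measurable borel"
        unfolding \<tau>_def by measurable
      have "AE x in H. indicator M x * (real (\<theta> x) * \<xi> x (\<phi> x)) = w x *\<^sub>R \<tau> x (\<phi> x)"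
        using good
      proof eventually_elim
        case (elim x)
        then show ?case
          using \<theta>_pos[of x] by (cases "x \<in> M") (auto simp: \<tau>_def w_def)
      qed
      then have "has_bochner_integral H (\<lambda>x. w x *\<^sub>R \<tau> x (\<phi> x)) (T \<phi>)"
        using T\<phi> by (subst has_bochner_integral_cong_AE[symmetric]) simp_all
      then show ?thesis
        unfolding \<mu>_def using w_nonneg by (intro has_bochner_integral_density) simp_all
    qed
  qed
  then show ?thesis
    by blast
qed

lemma polar_decomposition_polar:
  assumes "positive_spacelike T"
  shows "polar_decomposition T (mass_measure T) (orienting_field T)"
proof -
  have "\<exists>p. case p of (\<mu>, \<tau>) \<Rightarrow> polar_decomposition T \<mu> \<tau>"
    using exists_polar_decomposition[OF assms] by auto
  then have "case polar T of (\<mu>, \<tau>) \<Rightarrow> polar_decomposition T \<mu> \<tau>"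
    unfolding polar_def by (rule someI_ex)
  then show ?thesis
    by (simp add: mass_measure_def orienting_field_def case_prod_beta)
qed


section \<open>The comparison of volumes\<close>

text \<open>\<open>\<tau> x\<close> is a priori an arbitrary function of covectors; where it lies in
  \<open>G_space_plus\<close> it is evaluation at a frame.\<close>

lemma polar_decomposition_AE_test_form:
  fixes T :: "'n::{finite,linorder} current"
  assumes "polar_decomposition T \<mu> \<tau>"
  shows "AE x in \<mu>. \<forall>c. \<forall>\<alpha>\<in>covectors CARD('n). \<tau> x (\<lambda>vs. c * \<alpha> vs) = c * \<tau> x \<alpha>"
proof -
  have "AE x in \<mu>. \<tau> x \<in> G_space_plus"
    using assms by (simp add: polar_decomposition_def)
  then show ?thesis
  proof eventually_elim
    case (elim x)
    then show ?case
      by (rule G_space_plusE) (simp add: covectors_scale)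
  qed
qed

text \<open>Near a point off the support, \<open>T\<close> vanishes on a bump times
  \<open>Re dz\<close>. The integrand is nonnegative, and positive wherever the bump is, so the ball
  is null. Lindelof's theorem reduces the union of these balls to a countable one.\<close>

lemma compl_current_support_subset_null:
  fixes T :: "'n::{finite,linorder} current"
  assumes polar: "polar_decomposition T \<mu> \<tau>"
  shows "\<exists>N\<in>null_sets \<mu>. - current_support T \<subseteq> N"
proof -
  have sets [measurable_cong, simp]: "sets \<mu> = sets borel"
    and G: "AE x in \<mu>. \<tau> x \<in> G_space_plus"
    and int: "\<And>\<phi>. \<phi> \<in> test_forms CARD('n) \<Longrightarrow> has_bochner_integral \<mu> (\<lambda>x. \<tau> x (\<phi> x)) (T \<phi>)"
    using polar by (auto simp: polar_decomposition_def)
  have null: "\<exists>r>0. ball x r \<in> null_sets \<mu>" if x: "x \<notin> current_support T" for x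
  proof -
    obtain U where U: "open U" "x \<in> U"
      "\<And>\<phi>. \<phi> \<in> test_forms CARD('n) \<Longrightarrow> form_support \<phi> \<subseteq> U \<Longrightarrow> T \<phi> = 0"
      using x unfolding current_support_def by blast
    then obtain r where r: "r > 0" "cball x r \<subseteq> U"
      using open_contains_cball by blast
    obtain f where f: "\<And>k. C_k k f" "\<And>y. 0 \<le> f y" "\<And>y. f y \<noteq> 0 \<longleftrightarrow> y \<in> ball x r"
      using exists_smooth_bump[OF r(1), of x] by metis
    define \<phi> :: "'n Dn form" where "\<phi> = (\<lambda>y vs. f y * re_dz vs)"
    have "f y = 0" if "y \<notin> cball x r" for y
      using f(3)[of y] that by auto
    then have "\<phi> y vs = 0" if "y \<notin> cball x r" for y vs
      using that by (simp add: \<phi>_def)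
    moreover have "\<phi> y \<in> covectors CARD('n)" "C_k m (\<lambda>y. \<phi> y vs)" for y vs m
      unfolding \<phi>_def by (intro covectors_scale re_dz_in_covectors C_k_mult C_k_const f(1))+
    ultimately have \<phi>: "\<phi> \<in> test_forms CARD('n)" "form_support \<phi> \<subseteq> cball x r"
      using test_formsI[OF _ _ compact_cball] by blast+
    then have "has_bochner_integral \<mu> (\<lambda>y. \<tau> y (\<phi> y)) 0"
      using int[OF \<phi>(1)] U(3)[OF \<phi>(1)] r(2) by auto
    moreover have eq: "AE y in \<mu>. \<tau> y (\<phi> y) = f y * \<tau> y re_dz"
      using polar_decomposition_AE_test_form[OF polar]
      by eventually_elim (simp add: \<phi>_def re_dz_in_covectors)
    moreover have "AE y in \<mu>. 0 \<le> \<tau> y (\<phi> y)"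
      using eq G
    proof eventually_elim
      case (elim y)
      then show ?case
        using f(2)[of y] G_space_plus_re_dz_ge_1[of "\<tau> y"] by simp
    qed
    ultimately have "AE y in \<mu>. \<tau> y (\<phi> y) = 0"
      using integral_nonneg_eq_0_iff_AE[of \<mu> "\<lambda>y. \<tau> y (\<phi> y)"] by (simp add: has_bochner_integral_iff)
    then have "AE y in \<mu>. y \<notin> ball x r"
      using eq G
    proof eventually_elim
      case (elim y)
      then show ?case
        using f(3)[of y] G_space_plus_re_dz_ge_1[of "\<tau> y"] by auto
    qed
    moreover have "space \<mu> = UNIV"
      using sets_eq_imp_space_eq[OF sets] by simp
    ultimately have "ball x r \<in> null_sets \<mu>"
      by (subst AE_iff_null_sets) simp_all
    with r(1) show ?thesis
      by blast
  qed
  then obtain r where r: "\<And>x. x \<notin> current_support T \<Longrightarrow> r x > 0 \<and> ball x (r x) \<in> null_sets \<mu>"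
    by metis
  define \<F> where "\<F> = (\<lambda>x. ball x (r x)) ` (- current_support T)"
  have "open A" if "A \<in> \<F>" for A
    using that by (auto simp: \<F>_def)
  then obtain \<F>' where \<F>': "\<F>' \<subseteq> \<F>" "countable \<F>'" "\<Union>\<F>' = \<Union>\<F>"
    using Lindelof[of \<F>] by metis
  have "(\<Union>A\<in>\<F>'. A) \<in> null_sets \<mu>"
    using \<F>'(1,2) r by (intro null_sets_UN') (auto simp: \<F>_def)
  then have "\<Union>\<F> \<in> null_sets \<mu>"
    using \<F>'(3) by simp
  moreover have "- current_support T \<subseteq> \<Union>\<F>"
    using r by (force simp: \<F>_def)
  ultimately show ?thesis
    by blast
qed

lemma AE_current_support:
  assumes "polar_decomposition T \<mu> \<tau>"
  shows "AE x in \<mu>. x \<in> current_support T"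
proof -
  obtain N where "N \<in> null_sets \<mu>" "- current_support T \<subseteq> N"
    using compl_current_support_subset_null[OF assms] by blast
  then show ?thesis
    by (intro AE_I'[of N]) auto
qed

text \<open>Both claims come from one almost everywhere nonnegative function,
  \<open>\<tau> x re_dz - 1\<close>, whose integral is \<open>T \<phi> / n\<close> minus the volume.
  The factor \<open>n\<close> is the one produced by the radial primitive.\<close>

lemma vol_calibration:
  fixes T :: "'n::{finite,linorder} current"
  assumes T: "positive_spacelike T" and supp: "compact (current_support T)"
    and \<phi>: "\<phi> \<in> test_forms CARD('n)"
    and eq: "\<And>x. x \<in> current_support T \<Longrightarrow> \<phi> x = (\<lambda>vs. real CARD('n) * re_dz vs)"
  shows "vol T \<le> ennreal (T \<phi> / CARD('n))"
    and "vol T = ennreal (T \<phi> / CARD('n)) \<longleftrightarrow> (AE x in mass_measure T. orienting_field T x \<in> SLAG)"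
proof -
  define \<mu> where "\<mu> = mass_measure T"
  define \<tau> where "\<tau> = orienting_field T"
  have polar: "polar_decomposition T \<mu> \<tau>"
    unfolding \<mu>_def \<tau>_def using T by (rule polar_decomposition_polar)
  have sets [measurable_cong, simp]: "sets \<mu> = sets borel"
    and G: "AE x in \<mu>. \<tau> x \<in> G_space_plus"
    and int: "has_bochner_integral \<mu> (\<lambda>x. \<tau> x (\<phi> x)) (T \<phi>)"
    and fin: "emeasure \<mu> (current_support T) < \<infinity>"
    and meas: "(\<lambda>x. \<tau> x re_dz) \<in> borel_measurable borel"
    using polar \<phi> supp re_dz_in_covectors[where 'n = 'n] by (auto simp: polar_decomposition_def)
  have space [simp]: "space \<mu> = UNIV"
    using sets_eq_imp_space_eq[OF sets] by simp
  note supp_AE = AE_current_support[OF polar]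
  \<comment> \<open>The measure is carried by the compact support, so it is finite and the constant
    1 is integrable.\<close>
  have "emeasure \<mu> (space \<mu>) = emeasure \<mu> (current_support T)"
    using supp_AE supp by (intro emeasure_eq_AE) (auto simp: compact_imp_closed)
  then interpret finite_measure \<mu>
    using fin by (intro finite_measureI) auto
  have "AE x in \<mu>. \<tau> x (\<phi> x) = real CARD('n) * \<tau> x re_dz"
    using supp_AE polar_decomposition_AE_test_form[OF polar]
  proof eventually_elim
    case (elim x)
    then show ?case
      by (simp add: eq re_dz_in_covectors)
  qed
  then have "has_bochner_integral \<mu> (\<lambda>x. real CARD('n) * \<tau> x re_dz) (T \<phi>)"
    using int meas borel_measurable_has_bochner_integral[OF int]
    by (subst has_bochner_integral_cong_AE[symmetric, where f = "\<lambda>x. \<tau> x (\<phi> x)"]) simp_all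
  then have "has_bochner_integral \<mu> (\<lambda>x. \<tau> x re_dz) (T \<phi> / CARD('n))"
    using has_bochner_integral_mult_right[of "1 / real CARD('n)" \<mu> "\<lambda>x. real CARD('n) * \<tau> x re_dz" "T \<phi>"]
    by simp
  moreover have "has_bochner_integral \<mu> (\<lambda>x. 1) (measure \<mu> UNIV)"
    by (simp add: has_bochner_integral_iff)
  ultimately have diff: "has_bochner_integral \<mu> (\<lambda>x. \<tau> x re_dz - 1) (T \<phi> / CARD('n) - measure \<mu> UNIV)"
    by (rule has_bochner_integral_diff)
  have nonneg: "AE x in \<mu>. 0 \<le> \<tau> x re_dz - 1"
    using G by eventually_elim (simp add: G_space_plus_re_dz_ge_1)
  have vol: "vol T = ennreal (measure \<mu> UNIV)"
    by (simp add: vol_def \<mu>_def[symmetric] emeasure_eq_measure)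
  have le: "measure \<mu> UNIV \<le> T \<phi> / CARD('n)"
    using integral_nonneg_AE[OF nonneg] diff by (simp add: has_bochner_integral_iff)
  then show "vol T \<le> ennreal (T \<phi> / CARD('n))"
    by (simp add: vol ennreal_leI)
  have "vol T = ennreal (T \<phi> / CARD('n)) \<longleftrightarrow> measure \<mu> UNIV = T \<phi> / CARD('n)"
    unfolding vol using le by (subst ennreal_inj) (auto intro: order_trans[OF measure_nonneg])
  also have "\<dots> \<longleftrightarrow> integral\<^sup>L \<mu> (\<lambda>x. \<tau> x re_dz - 1) = 0"
    using diff by (auto simp: has_bochner_integral_iff)
  also have "\<dots> \<longleftrightarrow> (AE x in \<mu>. \<tau> x re_dz - 1 = 0)"
    using diff by (intro integral_nonneg_eq_0_iff_AE nonneg) (simp add: has_bochner_integral_iff)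
  also have "\<dots> \<longleftrightarrow> (AE x in \<mu>. \<tau> x \<in> SLAG)"
  proof
    assume "AE x in \<mu>. \<tau> x re_dz - 1 = 0"
    with G show "AE x in \<mu>. \<tau> x \<in> SLAG"
      by eventually_elim (simp add: G_space_plus_re_dz_eq_1_iff[symmetric])
  next
    assume "AE x in \<mu>. \<tau> x \<in> SLAG"
    with G show "AE x in \<mu>. \<tau> x re_dz - 1 = 0"
      by eventually_elim (simp add: G_space_plus_re_dz_eq_1_iff)
  qed
  finally show "vol T = ennreal (T \<phi> / CARD('n)) \<longleftrightarrow> (AE x in mass_measure T. orienting_field T x \<in> SLAG)"
    unfolding \<mu>_def \<tau>_def .
qed

lemma positive_spacelike_imp_locally_rectifiable: "positive_spacelike T \<Longrightarrow> locally_rectifiable T"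
  unfolding positive_spacelike_def locally_rectifiable_def by blast

theorem theoremE2:
  fixes T S :: "'n::{finite,linorder} current"
  assumes "split_SLAG T"
    and "compact (current_support T)"
    and "positive_spacelike S"
    and "compact (current_support S)"
    and "boundary S = boundary T"
  shows "vol T \<ge> vol S \<and> (vol T = vol S \<longleftrightarrow> split_SLAG S)"
proof -
  have T: "positive_spacelike T" "AE x in mass_measure T. orienting_field T x \<in> SLAG"
    using assms(1) by (simp_all add: split_SLAG_def)
  \<comment> \<open>The index type is nonempty, so \<open>CARD('n) - 1\<close> is a true predecessor
    and the primitive has the degree tested by \<open>boundary\<close>.\<close>
  obtain k where card: "CARD('n) = Suc k"
    using zero_less_card_finite[where 'a = 'n] gr0_implies_Suc by blast
  \<comment> \<open>One primitive must serve both currents, hence the union of the supports.\<close>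
  have "bounded (current_support T \<union> current_support S)"
    using assms(2,4) by (simp add: compact_imp_bounded)
  then obtain \<psi> :: "'n Dn form" where \<psi>: "\<psi> \<in> test_forms k" "ext_deriv \<psi> \<in> test_forms CARD('n)"
    "\<And>x. x \<in> current_support T \<union> current_support S \<Longrightarrow> ext_deriv \<psi> x = (\<lambda>vs. real CARD('n) * re_dz vs)"
    using exists_local_primitive[OF re_dz_in_covectors[where 'n = 'n, unfolded card]]
    unfolding card by metis
  have "boundary S \<psi> = boundary T \<psi>"
    by (simp add: assms(5))
  then have ST: "S (ext_deriv \<psi>) = T (ext_deriv \<psi>)"
    using \<psi>(1) by (simp add: boundary_def card)
  have "vol T = ennreal (T (ext_deriv \<psi>) / CARD('n))"
    using vol_calibration(2)[OF T(1) assms(2) \<psi>(2)] \<psi>(3) T(2) by simp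
  moreover have "vol S \<le> ennreal (T (ext_deriv \<psi>) / CARD('n))"
    using vol_calibration(1)[OF assms(3,4) \<psi>(2)] \<psi>(3) by (simp add: ST)
  moreover have "vol S = ennreal (T (ext_deriv \<psi>) / CARD('n)) \<longleftrightarrow> split_SLAG S"
    using vol_calibration(2)[OF assms(3,4) \<psi>(2)] \<psi>(3) assms(3)
      positive_spacelike_imp_locally_rectifiable[OF assms(3)] by (simp add: ST split_SLAG_def)
  ultimately show ?thesis
    by auto
qed

end
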